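(* Let $d\ge 2$, $\epsilon\in(0,1]$ and $\sigma\le \frac{\epsilon}{6\sqrt d}$. For every positive integer $k$ there exists a function $\mathcal{F}^\sigma_k:\mathcal{U}(d)\to\mathbb{R}$ with the following properties. (1) Normalisation: $\int_{\mathcal{U}(d)} \mathrm{d}\mu(\mathcal{U})\,\mathcal{F}^\sigma_k(\mathcal{U})=1$. (2) If $k\ge 5\frac{d^{3/2}}{\sigma}\sqrt{\frac18\frac{\epsilon^2}{d^2\sigma^2}+\log\frac1\sigma}$, then $\int_{B(\mathcal{I},\epsilon)^c}\mathrm{d}\mu(\mathcal{U})\,|\mathcal{F}^\sigma_k(\mathcal{U})|\le 9\exp\!\left(-\frac{\epsilon^2}{4\sigma^2}\right)\left(\frac{\pi}{2}\right)^{d(d-1)}$, where $B(\mathcal{I},\epsilon)^c$ is the complement in $\mathcal{U}(d)$ of the ball of radius $\epsilon$ around the identity channel $\mathcal{I}$. (3) $\mathcal{F}^\sigma_k$ is a balanced polynomial of degree $k$ in $U$ and $\bar U$, i.e. $\mathcal{F}^\sigma_k\in\mathcal{H}_k$. (4) If $k\ge d/\sigma$, then $\|\mathcal{F}^\sigma_k\|_2=\left(\int_{\mathcal{U}(d)}\mathrm{d}\mu(\mathcal{U})|\mathcal{F}^\sigma_k(\mathcal{U})|^2\right)^{1/2}\le 8\cdot 2^{d^2}\sigma^{-d(d-\frac12)}$.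
   Context: $\mathcal{U}(d)$ denotes the set of unitary channels $\mathcal{U}[\rho]=U\rho U^\dagger$ on $\mathbb{C}^d$, $U\in\mathrm{U}(d)$; it is identified with $\mathrm{U}(d)/\mathrm{U}(1)$, and functions on $\mathcal{U}(d)$ are identified with functions on $\mathrm{U}(d)$ invariant under $U\mapsto e^{i\alpha}U$. $\mu$ denotes the normalized Haar measure (on $\mathrm{U}(d)$, and its pushforward on $\mathcal{U}(d)$). The distance on $\mathcal{U}(d)$ is $\mathrm{D}(\mathcal{U},\mathcal{V})=\min_{\varphi\in[0,2\pi)}\|U-e^{i\varphi}V\|_\infty$ (operator norm), and $B(\mathcal{V},r)=\{\mathcal{U}\in\mathcal{U}(d):\mathrm{D}(\mathcal{U},\mathcal{V})\le r\}$. $\mathcal{H}_t$ is the linear span of functions $U\mapsto \mathrm{tr}(A\,U^{\otimes s}\otimes\bar U^{\otimes s})$ with $A$ an operator on $(\mathbb{C}^d)^{\otimes 2s}$ and $0\le s\le t$ (balanced polynomials of degree at most $t$). $\log$ is the natural logarithm. *)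

theory Defs
  imports "HOL-Probability.Probability"
begin

definition adjoint_mat :: "complex^'n^'n \<Rightarrow> complex^'n^'n" where
  "adjoint_mat U = (\<chi> i j. cnj (U $ j $ i))"

definition unitary_mats :: "(complex^'n^'n) set" where
  "unitary_mats = {U. U ** adjoint_mat U = mat 1 \<and> adjoint_mat U ** U = mat 1}"

definition opnorm :: "complex^'n^'n \<Rightarrow> real" where
  "opnorm A = onorm (\<lambda>x. A *v x)"

definition chan_dist :: "complex^'n^'n \<Rightarrow> complex^'n^'n \<Rightarrow> real" where
  "chan_dist U V = (INF \<phi>\<in>{0..<2*pi}. opnorm (U - (\<chi> a b. cis \<phi> * V $ a $ b)))"

text \<open>Normalized Haar measure on U(d): a Borel probability measure concentrated on
  the unitary matrices and invariant under left multiplication by unitaries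
  (such a measure is unique).\<close>
definition is_haar :: "(complex^'n^'n) measure \<Rightarrow> bool" where
  "is_haar \<mu> \<longleftrightarrow> prob_space \<mu> \<and> sets \<mu> = sets borel \<and> measure \<mu> unitary_mats = 1 \<and>
     (\<forall>V\<in>unitary_mats. distr \<mu> borel (\<lambda>U. V ** U) = \<mu>)"

definition balanced_poly :: "nat \<Rightarrow> (complex^'n^'n \<Rightarrow> complex) \<Rightarrow> bool" where
  "balanced_poly t f \<longleftrightarrow>
     (\<exists>(N::nat) (c::nat \<Rightarrow> complex) (s::nat \<Rightarrow> nat) (i::nat\<Rightarrow>nat\<Rightarrow>'n) j k l.
        (\<forall>m<N. s m \<le> t) \<and>
        (\<forall>U\<in>unitary_mats. f U = (\<Sum>m<N. c m *
            (\<Prod>a<s m. U $ i m a $ j m a * cnj (U $ k m a $ l m a)))))"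

end

theory Submission
  imports Defs
begin

text \<open>
  The kernel is a normalised polynomial in \<open>z(U) = \<bar>tr U\<bar>\<^sup>2 / d\<^sup>2 \<in> [0,1]\<close>, namely the truncation of
  the Chebyshev expansion of \<open>z^N\<close> with \<open>N \<approx> d/\<sigma>\<^sup>2\<close>. Truncating at degree \<open>k\<close> costs at most
  \<open>2 exp(-k\<^sup>2/N)\<close>, a binomial tail, which is negligible in the regime of property (2); below it the
  constant kernel suffices. Everything else is about the moments \<open>e\<^sub>N = E z^N\<close> under Haar measure.
  By left invariance \<open>e\<^sub>N = E\<^sub>U E\<^sub>V \<bar>\<langle>U,V\<rangle>\<bar>^(2N)\<close> for the normalised Hilbert-Schmidt inner product, so
  the multinomial theorem writes \<open>e\<^sub>N\<close> as a weighted sum of squares of the moments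
  \<open>T \<alpha> \<beta> = E[u^\<alpha> cnj(u^\<beta>)]\<close> of the matrix entries.

  Two consequences replace the Weyl integration formula. Since the entries have total weight one,
  \<open>T \<alpha> \<beta>\<close> is the sum of \<open>T (\<alpha> + e\<^sub>i) (\<beta> + e\<^sub>i)\<close> over \<open>i\<close>, and Cauchy-Schwarz gives
  \<open>(N + 1) e\<^sub>N \<le> (N + d\<^sup>2) e\<^sub>N\<^sub>+\<^sub>1\<close>; hence passing from \<open>2N/3\<close> to \<open>N\<close> loses at most \<open>(3/2)^(d\<^sup>2-1)\<close>, which bounds
  the mass outside the ball. Keeping only the diagonal terms \<open>T \<alpha> \<alpha>\<close> bounds \<open>e\<^sub>N\<close> from below by the
  reciprocal of the number of relevant \<open>\<alpha>\<close>; as every column of a unitary matrix is a unit vector, the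
  column sums of \<open>\<alpha>\<close> concentrate in windows of width \<open>N^(1/2)\<close>, and counting these \<open>\<alpha>\<close> yields exactly
  the exponent \<open>d(d - 1/2)\<close> of property (4).
\<close>

section \<open>Multinomial sums\<close>

definition multi_indices :: "nat \<Rightarrow> ('i::finite \<Rightarrow> nat) set" where
  "multi_indices N = {\<alpha>. (\<Sum>i\<in>UNIV. \<alpha> i) = N}"

definition multi_raise :: "'i \<Rightarrow> ('i \<Rightarrow> nat) \<Rightarrow> 'i \<Rightarrow> nat" where
  "multi_raise i \<alpha> = \<alpha>(i := Suc (\<alpha> i))"

definition multinom :: "('i::finite \<Rightarrow> nat) \<Rightarrow> real" where
  "multinom \<alpha> = fact (\<Sum>i\<in>UNIV. \<alpha> i) / (\<Prod>i\<in>UNIV. fact (\<alpha> i))"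

definition multi_power :: "('i::finite \<Rightarrow> 'a::comm_semiring_1) \<Rightarrow> ('i \<Rightarrow> nat) \<Rightarrow> 'a" where
  "multi_power x \<alpha> = (\<Prod>i\<in>UNIV. x i ^ \<alpha> i)"

lemma finite_multi_indices [simp]: "finite (multi_indices N :: ('i::finite \<Rightarrow> nat) set)"
proof (rule finite_subset)
  show "multi_indices N \<subseteq> PiE (UNIV :: 'i set) (\<lambda>_. {..N})"
    by (auto simp: multi_indices_def PiE_def Pi_def intro!: member_le_sum)
qed (auto intro: finite_PiE)

lemma sum_multi_raise: "(\<Sum>j\<in>UNIV. multi_raise i \<alpha> j * f j) = (\<Sum>j\<in>UNIV. \<alpha> j * f j) + (f i :: nat)"
  for i :: "'i::finite"
proof -
  have "(\<Sum>j\<in>UNIV. multi_raise i \<alpha> j * f j) = (\<Sum>j\<in>UNIV. \<alpha> j * f j + (if j = i then f i else 0))"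
    by (intro sum.cong) (auto simp: multi_raise_def)
  also have "\<dots> = (\<Sum>j\<in>UNIV. \<alpha> j * f j) + f i"
    by (subst sum.distrib) simp
  finally show ?thesis .
qed

lemma sum_multi_raise_1: "(\<Sum>j\<in>UNIV. multi_raise i \<alpha> j) = Suc (\<Sum>j\<in>UNIV. \<alpha> j)" for i :: "'i::finite"
  using sum_multi_raise[of i \<alpha> "\<lambda>_. 1"] by simp

lemma bij_betw_multi_raise:
  "bij_betw (multi_raise i) (multi_indices N) {\<alpha> \<in> multi_indices (Suc N). 0 < \<alpha> (i :: 'i::finite)}"
proof (rule bij_betwI[where g = "\<lambda>\<alpha>. \<alpha>(i := \<alpha> i - 1)"])
  show "multi_raise i \<in> multi_indices N \<rightarrow> {\<alpha> \<in> multi_indices (Suc N). 0 < \<alpha> i}"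
    by (auto simp: multi_indices_def sum_multi_raise_1) (simp add: multi_raise_def)
  show "(\<lambda>\<alpha>. \<alpha>(i := \<alpha> i - 1)) \<in> {\<alpha> \<in> multi_indices (Suc N). 0 < \<alpha> i} \<rightarrow> multi_indices N"
  proof
    fix \<alpha> assume a: "\<alpha> \<in> {\<alpha> \<in> multi_indices (Suc N). 0 < \<alpha> i}"
    then have "multi_raise i (\<alpha>(i := \<alpha> i - 1)) = \<alpha>"
      by (auto simp: multi_raise_def)
    with a show "\<alpha>(i := \<alpha> i - 1) \<in> multi_indices N"
      using sum_multi_raise_1[of i "\<alpha>(i := \<alpha> i - 1)"] by (simp add: multi_indices_def)
  qed
qed (auto simp: multi_raise_def)

lemma sum_multi_raise_eq:
  "(\<Sum>\<alpha>\<in>multi_indices N. f (multi_raise i \<alpha>)) =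
   (\<Sum>\<alpha> | \<alpha> \<in> multi_indices (Suc N) \<and> 0 < \<alpha> i. f \<alpha>)"
  by (rule sum.reindex_bij_betw[OF bij_betw_multi_raise])

lemma multinom_pos: "multinom \<alpha> > 0"
  by (auto simp: multinom_def intro!: divide_pos_pos prod_pos)

lemma multinom_multi_raise:
  "real (Suc (\<alpha> i)) * multinom (multi_raise i \<alpha>) = real (Suc (\<Sum>j\<in>UNIV. \<alpha> j)) * multinom \<alpha>"
proof -
  have "(\<Prod>j\<in>UNIV. fact (multi_raise i \<alpha> j)) = real (Suc (\<alpha> i)) * (\<Prod>j\<in>UNIV. fact (\<alpha> j))"
    by (subst (1 2) prod.remove[of _ i]) (auto simp: multi_raise_def mult.assoc intro!: prod.cong)
  moreover have "(\<Prod>j\<in>UNIV. fact (\<alpha> j)) \<noteq> (0::real)" by simp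
  ultimately show ?thesis
    unfolding multinom_def sum_multi_raise_1 by (simp add: divide_simps del: of_nat_Suc)
qed

lemma multi_power_multi_raise: "multi_power x (multi_raise i \<alpha>) = x i * multi_power x \<alpha>"
proof -
  have "multi_power x (multi_raise i \<alpha>) = (\<Prod>j\<in>UNIV. x j ^ \<alpha> j * (if j = i then x i else 1))"
    unfolding multi_power_def by (intro prod.cong) (auto simp: multi_raise_def mult.commute)
  also have "\<dots> = x i * multi_power x \<alpha>"
    by (subst prod.distrib) (simp add: multi_power_def mult.commute)
  finally show ?thesis .
qed

text \<open>The weight \<open>\<alpha> i\<close> kills the indices with
  \<open>\<alpha> i = 0\<close>; all others are raised from level \<open>N\<close>, and
  \<open>multinom_multi_raise\<close> turns the weight into the factor \<open>Suc N\<close>. With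
  \<open>g\<close> constant this drives the multinomial theorem; with \<open>g\<close> itself a
  linear statistic it gives second moments.\<close>

lemma sum_multinom_moment:
  fixes x :: "'i::finite \<Rightarrow> 'a::real_normed_field"
  shows "(\<Sum>\<alpha>\<in>multi_indices (Suc N). of_real (multinom \<alpha>) * multi_power x \<alpha> * of_nat (\<alpha> i) * g \<alpha>) =
    of_nat (Suc N) * x i *
      (\<Sum>\<alpha>\<in>multi_indices N. of_real (multinom \<alpha>) * multi_power x \<alpha> * g (multi_raise i \<alpha>))"
proof -
  let ?f = "\<lambda>\<alpha>. of_real (multinom \<alpha>) * multi_power x \<alpha> * of_nat (\<alpha> i) * g \<alpha>"
  have "sum ?f (multi_indices (Suc N)) = (\<Sum>\<alpha> | \<alpha> \<in> multi_indices (Suc N) \<and> 0 < \<alpha> i. ?f \<alpha>)"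
    by (intro sum.mono_neutral_right) auto
  also have "\<dots> = (\<Sum>\<alpha>\<in>multi_indices N. ?f (multi_raise i \<alpha>))"
    by (rule sum_multi_raise_eq[symmetric])
  also have "\<dots> = (\<Sum>\<alpha>\<in>multi_indices N. of_nat (Suc N) * x i *
      (of_real (multinom \<alpha>) * multi_power x \<alpha> * g (multi_raise i \<alpha>)))"
  proof (intro sum.cong refl)
    fix \<alpha> :: "'i \<Rightarrow> nat" assume "\<alpha> \<in> multi_indices N"
    then have N: "(\<Sum>j\<in>UNIV. \<alpha> j) = N" by (simp add: multi_indices_def)
    have "of_nat (multi_raise i \<alpha> i) * of_real (multinom (multi_raise i \<alpha>)) =
        (of_nat (Suc N) * of_real (multinom \<alpha>) :: 'a)"
      using arg_cong[OF multinom_multi_raise[of \<alpha> i], of "of_real :: real \<Rightarrow> 'a"]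
      by (simp add: N multi_raise_def)
    then show "?f (multi_raise i \<alpha>) = of_nat (Suc N) * x i *
      (of_real (multinom \<alpha>) * multi_power x \<alpha> * g (multi_raise i \<alpha>))"
      by (simp add: multi_power_multi_raise mult_ac del: of_nat_Suc)
  qed
  finally show ?thesis by (simp add: sum_distrib_left)
qed

lemma multi_indices_0: "multi_indices 0 = {\<lambda>_. 0}"
  by (auto simp: multi_indices_def)

text \<open>Multiplying level \<open>Suc N\<close> by \<open>Suc N\<close>, which is the sum of the
  \<open>\<alpha> i\<close>, lets \<open>sum_multinom_moment\<close> reduce each coordinate to level
  \<open>N\<close>.\<close>

theorem multinomial_theorem:
  fixes x :: "'i::finite \<Rightarrow> 'a::real_normed_field"
  shows "(\<Sum>i\<in>UNIV. x i) ^ N = (\<Sum>\<alpha>\<in>multi_indices N. of_real (multinom \<alpha>) * multi_power x \<alpha>)"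
proof (induction N)
  case 0
  show ?case by (simp add: multi_indices_0 multinom_def multi_power_def)
next
  case (Suc N)
  let ?A = "\<lambda>\<alpha>. of_real (multinom \<alpha>) * multi_power x \<alpha>"
  have "of_nat (Suc N) * (\<Sum>\<alpha>\<in>multi_indices (Suc N). ?A \<alpha>) =
      (\<Sum>\<alpha>\<in>multi_indices (Suc N). \<Sum>i\<in>UNIV. ?A \<alpha> * of_nat (\<alpha> i) * 1)"
  proof (subst sum_distrib_left, intro sum.cong refl)
    fix \<alpha> :: "'i \<Rightarrow> nat" assume "\<alpha> \<in> multi_indices (Suc N)"
    then have "of_nat (Suc N) * ?A \<alpha> = ?A \<alpha> * (\<Sum>i\<in>UNIV. of_nat (\<alpha> i))"
      by (simp add: multi_indices_def of_nat_sum[symmetric] mult.commute del: of_nat_sum of_nat_Suc)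
    then show "of_nat (Suc N) * ?A \<alpha> = (\<Sum>i\<in>UNIV. ?A \<alpha> * of_nat (\<alpha> i) * 1)"
      by (simp add: sum_distrib_left)
  qed
  also have "\<dots> = (\<Sum>i\<in>UNIV. of_nat (Suc N) * x i * (\<Sum>\<alpha>\<in>multi_indices N. ?A \<alpha> * 1))"
    by (subst sum.swap) (simp only: sum_multinom_moment)
  also have "\<dots> = of_nat (Suc N) * (\<Sum>i\<in>UNIV. x i) ^ Suc N"
    by (simp add: Suc.IH[symmetric] sum_distrib_left[symmetric] sum_distrib_right[symmetric] mult.assoc del: of_nat_Suc)
  finally show ?case
    by (simp del: of_nat_Suc)
qed

section \<open>Growth of the weighted energy of a moment family\<close>

lemma sum_sqrt_mult_le:
  fixes a b :: "'i \<Rightarrow> real"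
  assumes "\<And>i. a i \<ge> 0" "\<And>i. b i \<ge> 0" "sum a I = S" "sum b I = S"
  shows "(\<Sum>i\<in>I. sqrt (a i * b i)) \<le> S"
proof -
  have "(\<Sum>i\<in>I. sqrt (a i * b i)) \<le> (\<Sum>i\<in>I. (a i + b i) / 2)"
    by (intro sum_mono arith_geo_mean_sqrt assms)
  also have "\<dots> = S"
    using assms by (simp add: sum_divide_distrib[symmetric] sum.distrib)
  finally show ?thesis .
qed

text \<open>Since \<open>multinom\<close> counts the words of length \<open>N\<close> with a given
  content, this is the squared Hilbert-Schmidt norm of \<open>T\<close> viewed as a matrix indexed
  by words. For \<open>T = haar_moment \<mu>\<close> with \<open>\<mu>\<close> Haar it is the
  \<open>N\<close>-th moment of \<open>trace_overlap\<close>.\<close>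

definition multi_energy :: "(('i::finite \<Rightarrow> nat) \<Rightarrow> ('i \<Rightarrow> nat) \<Rightarrow> complex) \<Rightarrow> nat \<Rightarrow> real" where
  "multi_energy T N = (\<Sum>\<alpha>\<in>multi_indices N. \<Sum>\<beta>\<in>multi_indices N.
     multinom \<alpha> * multinom \<beta> * (cmod (T \<alpha> \<beta>))\<^sup>2)"

text \<open>Expand each \<open>T \<alpha> \<beta>\<close> by the hypothesis and apply a weighted
  Cauchy-Schwarz inequality. The weights are chosen so that their sum is controlled by AM-GM both at
  level \<open>N\<close>, giving \<open>N + CARD('i)\<close>, and after raising, giving
  \<open>N + 1\<close>.\<close>

lemma multi_energy_Suc:
  fixes T :: "('i::finite \<Rightarrow> nat) \<Rightarrow> ('i \<Rightarrow> nat) \<Rightarrow> complex"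
  assumes T: "\<And>\<alpha> \<beta>. T \<alpha> \<beta> = (\<Sum>i\<in>UNIV. T (multi_raise i \<alpha>) (multi_raise i \<beta>))"
  shows "real (Suc N) * multi_energy T N \<le> real (N + CARD('i)) * multi_energy T (Suc N)"
proof -
  define g where "g = (\<lambda>i \<alpha> \<beta>. multinom \<alpha> * multinom \<beta> * (cmod (T \<alpha> \<beta>))\<^sup>2 *
    sqrt (real (\<alpha> i) * real (\<beta> i)) / (real (Suc N))\<^sup>2)"
  have g_nonneg: "g i \<alpha> \<beta> \<ge> 0" for i \<alpha> \<beta>
    using multinom_pos[of \<alpha>] multinom_pos[of \<beta>] by (simp add: g_def)
  have step: "multinom \<alpha> * multinom \<beta> * (cmod (T \<alpha> \<beta>))\<^sup>2
      \<le> real (N + CARD('i)) * (\<Sum>i\<in>UNIV. g i (multi_raise i \<alpha>) (multi_raise i \<beta>))"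
    if "\<alpha> \<in> multi_indices N" "\<beta> \<in> multi_indices N" for \<alpha> \<beta> :: "'i \<Rightarrow> nat"
  proof -
    have N: "(\<Sum>i\<in>UNIV. \<alpha> i) = N" "(\<Sum>i\<in>UNIV. \<beta> i) = N"
      using that by (auto simp: multi_indices_def)
    define t where "t i = cmod (T (multi_raise i \<alpha>) (multi_raise i \<beta>))" for i
    \<comment> \<open>The Cauchy-Schwarz weights are the geometric means of
      \<open>\<alpha> i + 1\<close> and \<open>\<beta> i + 1\<close>.\<close>
    define w where "w i = sqrt (real (Suc (\<alpha> i)) * real (Suc (\<beta> i)))" for i
    have w_pos: "w i > 0" for i by (simp add: w_def)
    have w_le: "(\<Sum>i\<in>UNIV. w i) \<le> real (N + CARD('i))"
      unfolding w_def using N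
      by (intro sum_sqrt_mult_le) (auto simp: sum.distrib of_nat_sum[symmetric] simp del: of_nat_sum)
    have "cmod (T \<alpha> \<beta>) \<le> (\<Sum>i\<in>UNIV. t i)"
      unfolding t_def by (subst T) (rule norm_sum)
    then have "(cmod (T \<alpha> \<beta>))\<^sup>2 \<le> (\<Sum>i\<in>UNIV. sqrt (w i) * (t i / sqrt (w i)))\<^sup>2"
      using w_pos by (intro power_mono) (simp_all add: less_imp_neq[THEN not_sym])
    also have "\<dots> \<le> (\<Sum>i\<in>UNIV. (sqrt (w i))\<^sup>2) * (\<Sum>i\<in>UNIV. (t i / sqrt (w i))\<^sup>2)"
      by (rule Cauchy_Schwarz_ineq_sum)
    also have "\<dots> = (\<Sum>i\<in>UNIV. w i) * (\<Sum>i\<in>UNIV. (t i)\<^sup>2 / w i)"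
      using w_pos by (simp add: power_divide less_imp_le)
    also have "\<dots> \<le> real (N + CARD('i)) * (\<Sum>i\<in>UNIV. (t i)\<^sup>2 / w i)"
      by (intro mult_right_mono[OF w_le] sum_nonneg divide_nonneg_nonneg less_imp_le[OF w_pos]) simp
    finally have "multinom \<alpha> * multinom \<beta> * (cmod (T \<alpha> \<beta>))\<^sup>2 \<le>
        multinom \<alpha> * multinom \<beta> * (real (N + CARD('i)) * (\<Sum>i\<in>UNIV. (t i)\<^sup>2 / w i))"
      using multinom_pos[of \<alpha>] multinom_pos[of \<beta>] by (intro mult_left_mono) auto
    also have "\<dots> = real (N + CARD('i)) * (\<Sum>i\<in>UNIV. multinom \<alpha> * multinom \<beta> * ((t i)\<^sup>2 / w i))"
      by (simp add: sum_distrib_left mult_ac)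
    also have "(\<Sum>i\<in>UNIV. multinom \<alpha> * multinom \<beta> * ((t i)\<^sup>2 / w i)) =
        (\<Sum>i\<in>UNIV. g i (multi_raise i \<alpha>) (multi_raise i \<beta>))"
    proof (intro sum.cong refl)
      fix i
      have a: "multinom \<gamma> = real (Suc (\<gamma> i)) * multinom (multi_raise i \<gamma>) / real (Suc N)"
        if "(\<Sum>i\<in>UNIV. \<gamma> i) = N" for \<gamma> :: "'i \<Rightarrow> nat"
        using multinom_multi_raise[of \<gamma> i] that by (simp add: field_simps)
      have w2: "real (Suc (\<alpha> i)) * real (Suc (\<beta> i)) = w i * w i"
        by (simp add: w_def)
      \<comment> \<open>Raising both multinomial coefficients produces the factor
        \<open>w i * w i\<close>. Cauchy-Schwarz has divided by \<open>w i\<close>, so one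
        \<open>w i\<close> survives, and this is the square root in \<open>g\<close> at the raised
        indices.\<close>
      have "multinom \<alpha> * multinom \<beta> * ((t i)\<^sup>2 / w i) = multinom (multi_raise i \<alpha>) *
          multinom (multi_raise i \<beta>) * (t i)\<^sup>2 *
          (real (Suc (\<alpha> i)) * real (Suc (\<beta> i))) / w i / (real (Suc N))\<^sup>2"
        by (subst (1 2) a) (simp_all add: N power2_eq_square mult_ac)
      also have "\<dots> = g i (multi_raise i \<alpha>) (multi_raise i \<beta>)"
      proof -
        have e: "x * (w i * w i) / w i / y = x * w i / y" for x y
          using w_pos[of i] by simp
        have w: "w i = sqrt (real (multi_raise i \<alpha> i) * real (multi_raise i \<beta> i))"
          by (simp add: w_def multi_raise_def)
        show ?thesis
          unfolding w2 e by (simp only: g_def t_def w)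
      qed
      finally show "multinom \<alpha> * multinom \<beta> * ((t i)\<^sup>2 / w i) =
        g i (multi_raise i \<alpha>) (multi_raise i \<beta>)" .
    qed
    finally show ?thesis .
  qed
  \<comment> \<open>Raised indices are exactly those of level \<open>Suc N\<close> with positive
    \<open>i\<close>-th entry, so for nonnegative \<open>h\<close> they contribute only a part of
    the full sum.\<close>
  have le: "(\<Sum>\<alpha>\<in>multi_indices N. h (multi_raise i \<alpha>)) \<le> (\<Sum>\<alpha>\<in>multi_indices (Suc N). h \<alpha>)"
    if "\<And>\<alpha>. h \<alpha> \<ge> 0" for h :: "('i \<Rightarrow> nat) \<Rightarrow> real" and i
    unfolding sum_multi_raise_eq by (intro sum_mono2) (auto simp: that)
  have "multi_energy T N \<le> (\<Sum>\<alpha>\<in>multi_indices N. \<Sum>\<beta>\<in>multi_indices N.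
      real (N + CARD('i)) * (\<Sum>i\<in>UNIV. g i (multi_raise i \<alpha>) (multi_raise i \<beta>)))"
    unfolding multi_energy_def by (intro sum_mono step)
  also have "\<dots> = real (N + CARD('i)) * (\<Sum>i\<in>UNIV. \<Sum>\<alpha>\<in>multi_indices N. \<Sum>\<beta>\<in>multi_indices N.
      g i (multi_raise i \<alpha>) (multi_raise i \<beta>))"
    by (simp add: sum_distrib_left sum.swap[of _ _ UNIV])
  also have "\<dots> \<le> real (N + CARD('i)) * (\<Sum>i\<in>UNIV. \<Sum>\<alpha>\<in>multi_indices (Suc N). \<Sum>\<beta>\<in>multi_indices (Suc N).
      g i \<alpha> \<beta>)"
  proof (intro mult_left_mono sum_mono)
    fix i
    have "(\<Sum>\<alpha>\<in>multi_indices N. \<Sum>\<beta>\<in>multi_indices N. g i (multi_raise i \<alpha>) (multi_raise i \<beta>)) \<le>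
        (\<Sum>\<alpha>\<in>multi_indices N. \<Sum>\<beta>\<in>multi_indices (Suc N). g i (multi_raise i \<alpha>) \<beta>)"
      by (intro sum_mono le g_nonneg)
    also have "\<dots> \<le> (\<Sum>\<alpha>\<in>multi_indices (Suc N). \<Sum>\<beta>\<in>multi_indices (Suc N). g i \<alpha> \<beta>)"
      by (intro le sum_nonneg g_nonneg)
    finally show "(\<Sum>\<alpha>\<in>multi_indices N. \<Sum>\<beta>\<in>multi_indices N. g i (multi_raise i \<alpha>) (multi_raise i \<beta>)) \<le>
      (\<Sum>\<alpha>\<in>multi_indices (Suc N). \<Sum>\<beta>\<in>multi_indices (Suc N). g i \<alpha> \<beta>)" .
  qed simp
  finally have 1: "multi_energy T N \<le> real (N + CARD('i)) *
    (\<Sum>i\<in>UNIV. \<Sum>\<alpha>\<in>multi_indices (Suc N). \<Sum>\<beta>\<in>multi_indices (Suc N). g i \<alpha> \<beta>)" .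
  have "(\<Sum>i\<in>UNIV. \<Sum>\<alpha>\<in>multi_indices (Suc N). \<Sum>\<beta>\<in>multi_indices (Suc N). g i \<alpha> \<beta>) =
      (\<Sum>\<alpha>\<in>multi_indices (Suc N). \<Sum>\<beta>\<in>multi_indices (Suc N). \<Sum>i\<in>UNIV. g i \<alpha> \<beta>)"
    by (simp add: sum.swap[of _ UNIV])
  also have "\<dots> \<le> (\<Sum>\<alpha>\<in>multi_indices (Suc N). \<Sum>\<beta>\<in>multi_indices (Suc N).
      multinom \<alpha> * multinom \<beta> * (cmod (T \<alpha> \<beta>))\<^sup>2 / real (Suc N))"
  proof (intro sum_mono)
    fix \<alpha> \<beta> :: "'i \<Rightarrow> nat" assume ab: "\<alpha> \<in> multi_indices (Suc N)" "\<beta> \<in> multi_indices (Suc N)"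
    let ?c = "multinom \<alpha> * multinom \<beta> * (cmod (T \<alpha> \<beta>))\<^sup>2 / (real (Suc N))\<^sup>2"
    \<comment> \<open>AM-GM at level \<open>Suc N\<close> cancels one of the two factors
      \<open>Suc N\<close> in the denominator of \<open>g\<close>.\<close>
    have "(\<Sum>i\<in>UNIV. sqrt (real (\<alpha> i) * real (\<beta> i))) \<le> real (Suc N)"
      using ab by (intro sum_sqrt_mult_le)
        (auto simp: multi_indices_def of_nat_sum[symmetric] simp del: of_nat_sum of_nat_Suc)
    then have "?c * (\<Sum>i\<in>UNIV. sqrt (real (\<alpha> i) * real (\<beta> i))) \<le> ?c * real (Suc N)"
      using multinom_pos[of \<alpha>] multinom_pos[of \<beta>] by (intro mult_left_mono) auto
    then show "(\<Sum>i\<in>UNIV. g i \<alpha> \<beta>) \<le>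
        multinom \<alpha> * multinom \<beta> * (cmod (T \<alpha> \<beta>))\<^sup>2 / real (Suc N)"
      by (simp add: g_def sum_distrib_left power2_eq_square del: of_nat_Suc)
  qed
  also have "\<dots> = multi_energy T (Suc N) / real (Suc N)"
    by (simp add: multi_energy_def sum_divide_distrib)
  finally have "multi_energy T N \<le> real (N + CARD('i)) * (multi_energy T (Suc N) / real (Suc N))"
    by (intro order.trans[OF 1] mult_left_mono) auto
  then show ?thesis
    by (simp add: pos_le_divide_eq mult.commute del: of_nat_Suc)
qed

lemma multi_energy_nonneg: "multi_energy T N \<ge> 0"
  unfolding multi_energy_def using multinom_pos
  by (intro sum_nonneg mult_nonneg_nonneg) (auto intro: less_imp_le)

text \<open>From \<open>n\<close> to \<open>n + 1\<close> the binomial coefficient grows by the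
  factor \<open>(n + p + 1) / (n + 1)\<close>, which is the largest factor by which
  \<open>multi_energy_Suc\<close> allows the energy to shrink. Hence the product is
  monotone.\<close>

lemma multi_energy_binomial_mono:
  fixes T :: "('i::finite \<Rightarrow> nat) \<Rightarrow> ('i \<Rightarrow> nat) \<Rightarrow> complex"
  assumes T: "\<And>\<alpha> \<beta>. T \<alpha> \<beta> = (\<Sum>i\<in>UNIV. T (multi_raise i \<alpha>) (multi_raise i \<beta>))"
    and D: "CARD('i) = Suc p" and "m \<le> n"
  shows "multi_energy T m * real ((m + p) choose p) \<le> multi_energy T n * real ((n + p) choose p)"
  using \<open>m \<le> n\<close>
proof (induction n rule: dec_induct)
  case (step n)
  have "Suc n * ((Suc n + p) choose p) = Suc (n + p) * ((n + p) choose p)"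
    using Suc_times_binomial_eq[of "n + p" n] binomial_symmetric[of n "n + p"]
      binomial_symmetric[of "Suc n" "Suc n + p"] by simp
  then have e: "real (Suc n) * real ((Suc n + p) choose p) = real (Suc (n + p)) * real ((n + p) choose p)"
    by (metis of_nat_mult)
  have "real (Suc n) * (multi_energy T n * real ((n + p) choose p)) \<le>
      real (n + CARD('i)) * multi_energy T (Suc n) * real ((n + p) choose p)"
    using mult_right_mono[OF multi_energy_Suc[of T n, OF T], of "real ((n + p) choose p)"]
    by (simp add: mult.assoc)
  also have "\<dots> = multi_energy T (Suc n) * (real (Suc (n + p)) * real ((n + p) choose p))"
    by (simp add: D)
  also have "\<dots> = real (Suc n) * (multi_energy T (Suc n) * real ((Suc n + p) choose p))"
    unfolding e[symmetric] by simp
  finally have "multi_energy T n * real ((n + p) choose p) \<le>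
      multi_energy T (Suc n) * real ((Suc n + p) choose p)"
    by (simp del: of_nat_Suc add_Suc binomial_Suc_Suc)
  with step.IH show ?case by simp
qed simp

text \<open>Each step in \<open>p\<close> multiplies the ratio of the two binomial coefficients by
  \<open>(3 * q + p + 1) / (2 * q + p + 1)\<close>, which is at most \<open>3 / 2\<close>.\<close>

lemma binomial_ratio_le: "2 ^ p * ((3 * q + p) choose p) \<le> 3 ^ p * ((2 * q + p) choose p)"
proof (induction p)
  case (Suc p)
  have e: "Suc p * ((n + Suc p) choose Suc p) = Suc (n + p) * ((n + p) choose p)" for n
    using Suc_times_binomial_eq[of "n + p" p] by simp
  have "Suc p * (2 ^ Suc p * ((3 * q + Suc p) choose Suc p)) =
      2 * Suc (3 * q + p) * (2 ^ p * ((3 * q + p) choose p))"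
    using e[of "3 * q"] by (simp add: mult_ac del: binomial_Suc_Suc mult_Suc mult_Suc_right)
  also have "\<dots> \<le> 3 * Suc (2 * q + p) * (3 ^ p * ((2 * q + p) choose p))"
    by (rule mult_mono[OF _ Suc.IH]) auto
  also have "\<dots> = Suc p * (3 ^ Suc p * ((2 * q + Suc p) choose Suc p))"
    using e[of "2 * q"] by (simp add: mult_ac del: binomial_Suc_Suc mult_Suc mult_Suc_right)
  finally show ?case
    by (simp del: binomial_Suc_Suc mult_Suc add_Suc_right power_Suc)
qed simp

text \<open>The loss does not depend on \<open>q\<close>. This is what makes it affordable to spend
  a third of the exponent on the Gaussian factor in the tail estimate.\<close>

lemma multi_energy_doubling:
  fixes T :: "('i::finite \<Rightarrow> nat) \<Rightarrow> ('i \<Rightarrow> nat) \<Rightarrow> complex"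
  assumes T: "\<And>\<alpha> \<beta>. T \<alpha> \<beta> = (\<Sum>i\<in>UNIV. T (multi_raise i \<alpha>) (multi_raise i \<beta>))"
  shows "multi_energy T (2 * q) \<le> (3 / 2) ^ (CARD('i) - 1) * multi_energy T (3 * q)"
proof -
  define p where "p = CARD('i) - 1"
  have D: "CARD('i) = Suc p"
    by (simp add: p_def)
  have "multi_energy T (2 * q) * real ((2 * q + p) choose p) \<le>
      multi_energy T (3 * q) * real ((3 * q + p) choose p)"
    by (rule multi_energy_binomial_mono[of T, OF T D]) simp
  also have "\<dots> \<le> multi_energy T (3 * q) * ((3 / 2) ^ p * real ((2 * q + p) choose p))"
  proof (intro mult_left_mono multi_energy_nonneg)
    have "real (2 ^ p * ((3 * q + p) choose p)) \<le> real (3 ^ p * ((2 * q + p) choose p))"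
      by (rule of_nat_mono[OF binomial_ratio_le])
    then show "real ((3 * q + p) choose p) \<le> (3 / 2) ^ p * real ((2 * q + p) choose p)"
      by (simp add: power_divide field_simps)
  qed
  finally have "multi_energy T (2 * q) * real ((2 * q + p) choose p) \<le>
    ((3 / 2) ^ p * multi_energy T (3 * q)) * real ((2 * q + p) choose p)"
    by (simp add: mult_ac)
  then show ?thesis
    unfolding p_def[symmetric] by (rule mult_right_le_imp_le) simp
qed

section \<open>Concentration of column sums and counting of balanced indices\<close>

definition column_sum :: "('r::finite \<times> 'c \<Rightarrow> nat) \<Rightarrow> 'c \<Rightarrow> nat" where
  "column_sum \<alpha> j = (\<Sum>i\<in>UNIV. \<alpha> (i, j))"

text \<open>The window is sized for Chebyshev's inequality: each column sum has mean
  \<open>M\<close> and variance at most \<open>M\<close>, so with \<open>CARD('c)\<close> columns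
  the total failure probability is at most one half.\<close>

definition balanced_multi_indices :: "nat \<Rightarrow> ('r::finite \<times> 'c::finite \<Rightarrow> nat) set" where
  "balanced_multi_indices M = {\<alpha> \<in> multi_indices (CARD('c) * M).
     \<forall>j. (real (column_sum \<alpha> j) - real M)\<^sup>2 \<le> 2 * real CARD('c) * real M}"

lemma sum_UNIV_prod: "(\<Sum>p\<in>UNIV. f p) = (\<Sum>j\<in>UNIV. \<Sum>i\<in>UNIV. f (i, j))"
  for f :: "'r::finite \<times> 'c::finite \<Rightarrow> 'a::comm_monoid_add"
  by (subst sum.swap) (simp add: sum.cartesian_product UNIV_Times_UNIV[symmetric] del: UNIV_Times_UNIV)

text \<open>The summands are the probabilities of a multinomial distribution with
  \<open>CARD('c) * M\<close> trials and cell probabilities \<open>x\<close>. Its column sums are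
  binomial with success probability \<open>1 / CARD('c)\<close>, and Chebyshev's inequality with a
  union bound over the columns applies.\<close>

lemma sum_balanced_multi_indices_ge:
  fixes x :: "'r::finite \<times> 'c::finite \<Rightarrow> real"
  assumes x: "\<And>p. x p \<ge> 0" "\<And>j. (\<Sum>i\<in>UNIV. x (i, j)) = 1 / real CARD('c)" and "M > 0"
  shows "(\<Sum>\<alpha>\<in>balanced_multi_indices M. multinom \<alpha> * multi_power x \<alpha>) \<ge> 1 / 2"
proof -
  define d where "d = real CARD('c)"
  have d: "d \<ge> 1" by (simp add: d_def Suc_leI)
  define A where "A \<alpha> = multinom \<alpha> * multi_power x \<alpha>" for \<alpha>
  have A_nonneg: "A \<alpha> \<ge> 0" for \<alpha>
    using multinom_pos[of \<alpha>] x by (auto simp: A_def multi_power_def intro!: mult_nonneg_nonneg prod_nonneg)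
  have "(\<Sum>p\<in>UNIV. x p) = 1"
    by (simp add: sum_UNIV_prod x)
  then have total: "(\<Sum>\<alpha>\<in>multi_indices N. A \<alpha>) = 1" for N
    using multinomial_theorem[of x N] by (simp add: A_def)
  \<comment> \<open>Taking \<open>g\<close> constant gives the mean; taking \<open>g\<close> to be
    the column sum itself gives the second moment.\<close>
  have moment: "(\<Sum>\<alpha>\<in>multi_indices (Suc N). A \<alpha> * real (column_sum \<alpha> j) * g \<alpha>) =
      (\<Sum>i\<in>UNIV. real (Suc N) * x (i, j) * (\<Sum>\<alpha>\<in>multi_indices N. A \<alpha> * g (multi_raise (i, j) \<alpha>)))"
    for N j g
  proof -
    have "(\<Sum>\<alpha>\<in>multi_indices (Suc N). A \<alpha> * real (column_sum \<alpha> j) * g \<alpha>) =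
        (\<Sum>i\<in>UNIV. \<Sum>\<alpha>\<in>multi_indices (Suc N). multinom \<alpha> * multi_power x \<alpha> * real (\<alpha> (i, j)) * g \<alpha>)"
      by (subst sum.swap) (simp add: A_def column_sum_def sum_distrib_left sum_distrib_right)
    then show ?thesis
      using sum_multinom_moment[where x = x and N = N and g = g] by (simp add: A_def)
  qed
  have first: "(\<Sum>\<alpha>\<in>multi_indices N. A \<alpha> * real (column_sum \<alpha> j)) = real N / d" for N j
  proof (cases N)
    case 0
    then show ?thesis by (simp add: multi_indices_0 column_sum_def)
  next
    case (Suc K)
    have "(\<Sum>\<alpha>\<in>multi_indices (Suc K). A \<alpha> * real (column_sum \<alpha> j) * 1) = (\<Sum>i\<in>UNIV. real (Suc K) * x (i, j))"
      by (subst moment) (simp add: total)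
    also have "\<dots> = real (Suc K) / d"
      by (simp only: sum_distrib_left[symmetric] x d_def) simp
    finally show ?thesis by (simp add: Suc)
  qed
  have raise: "column_sum (multi_raise (i, j) \<alpha>) j = Suc (column_sum \<alpha> j)" for i j and \<alpha> :: "'r \<times> 'c \<Rightarrow> nat"
  proof -
    have "column_sum (multi_raise (i, j) \<alpha>) j = (\<Sum>i'\<in>UNIV. multi_raise i (\<lambda>i'. \<alpha> (i', j)) i')"
      by (simp add: column_sum_def multi_raise_def fun_upd_def)
    then show ?thesis by (simp add: sum_multi_raise_1 column_sum_def)
  qed
  \<comment> \<open>Each use of \<open>moment\<close> removes one trial, so the second moment at
    \<open>N = Suc K\<close> involves the mean at \<open>K\<close>.\<close>
  define N where "N = CARD('c) * M"
  obtain K where K: "N = Suc K"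
    using \<open>M > 0\<close> by (metis N_def gr0_implies_Suc nat_0_less_mult_iff zero_less_card_finite)
  have Nd: "real N = d * real M" by (simp add: N_def d_def)
  have second: "(\<Sum>\<alpha>\<in>multi_indices N. A \<alpha> * (real (column_sum \<alpha> j) - real M)\<^sup>2) \<le> real M" for j
  proof -
    have "(\<Sum>\<alpha>\<in>multi_indices N. A \<alpha> * real (column_sum \<alpha> j) * real (column_sum \<alpha> j)) =
        (\<Sum>i\<in>UNIV. real N * x (i, j) * (real K / d + 1))"
      unfolding K by (subst moment) (simp add: raise distrib_left sum.distrib first total)
    also have "\<dots> = real M * (real K / d + 1)"
      using d by (simp only: sum_distrib_left[symmetric] sum_distrib_right[symmetric] x d_def[symmetric] Nd) simp
    also have "real K = d * real M - 1"
      using Nd K by simp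
    finally have s2: "(\<Sum>\<alpha>\<in>multi_indices N. A \<alpha> * (real (column_sum \<alpha> j))\<^sup>2) =
        real M * ((d * real M - 1) / d + 1)"
      by (simp add: power2_eq_square mult.assoc)
    have "(\<Sum>\<alpha>\<in>multi_indices N. A \<alpha> * (real (column_sum \<alpha> j) - real M)\<^sup>2) =
        (\<Sum>\<alpha>\<in>multi_indices N. A \<alpha> * (real (column_sum \<alpha> j))\<^sup>2
          - 2 * real M * (A \<alpha> * real (column_sum \<alpha> j)) + (real M)\<^sup>2 * A \<alpha>)"
      by (intro sum.cong) (auto simp: power2_eq_square algebra_simps)
    also have "\<dots> = real M * ((d * real M - 1) / d + 1) - 2 * real M * (real N / d) + (real M)\<^sup>2"
      by (simp only: sum.distrib sum_subtractf sum_distrib_left[symmetric] s2 first total)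
    also have "\<dots> = real M - real M / d"
      using d by (simp add: Nd field_simps power2_eq_square)
    also have "\<dots> \<le> real M" using d by simp
    finally show ?thesis .
  qed
  let ?B = "balanced_multi_indices M :: ('r \<times> 'c \<Rightarrow> nat) set"
  have B: "?B \<subseteq> multi_indices N" by (auto simp: balanced_multi_indices_def N_def)
  \<comment> \<open>Chebyshev and the union bound in one step: outside the balanced set some column
    violates its window, so the sum of all squared deviations already exceeds
    \<open>2 * d * M\<close>.\<close>
  have "2 * d * real M * (\<Sum>\<alpha>\<in>multi_indices N - ?B. A \<alpha>) \<le>
      (\<Sum>\<alpha>\<in>multi_indices N - ?B. A \<alpha> * (\<Sum>j\<in>UNIV. (real (column_sum \<alpha> j) - real M)\<^sup>2))"
    unfolding sum_distrib_left
  proof (intro sum_mono)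
    fix \<alpha> assume "\<alpha> \<in> multi_indices N - ?B"
    then obtain j where "(real (column_sum \<alpha> j) - real M)\<^sup>2 > 2 * d * real M"
      by (auto simp: balanced_multi_indices_def N_def d_def not_le)
    also have "(real (column_sum \<alpha> j) - real M)\<^sup>2 \<le> (\<Sum>j\<in>UNIV. (real (column_sum \<alpha> j) - real M)\<^sup>2)"
      by (intro member_le_sum) auto
    finally show "2 * d * real M * A \<alpha> \<le> (\<Sum>j\<in>UNIV. A \<alpha> * (real (column_sum \<alpha> j) - real M)\<^sup>2)"
      using A_nonneg[of \<alpha>] by (simp add: sum_distrib_left[symmetric] mult.commute mult_left_mono)
  qed
  also have "\<dots> \<le> (\<Sum>\<alpha>\<in>multi_indices N. A \<alpha> * (\<Sum>j\<in>UNIV. (real (column_sum \<alpha> j) - real M)\<^sup>2))"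
    by (intro sum_mono2) (auto intro!: mult_nonneg_nonneg A_nonneg sum_nonneg)
  also have "\<dots> = (\<Sum>j\<in>UNIV. \<Sum>\<alpha>\<in>multi_indices N. A \<alpha> * (real (column_sum \<alpha> j) - real M)\<^sup>2)"
    by (subst sum.swap) (simp add: sum_distrib_left)
  also have "\<dots> \<le> (\<Sum>j\<in>(UNIV::'c set). real M)"
    by (intro sum_mono second)
  also have "\<dots> = d * real M" by (simp add: d_def)
  finally have "2 * (d * real M) * (\<Sum>\<alpha>\<in>multi_indices N - ?B. A \<alpha>) \<le> d * real M"
    by simp
  then have "(\<Sum>\<alpha>\<in>multi_indices N - ?B. A \<alpha>) \<le> 1 / 2"
    using d \<open>M > 0\<close> by (simp add: field_simps)
  moreover have "(\<Sum>\<alpha>\<in>multi_indices N. A \<alpha>) = (\<Sum>\<alpha>\<in>multi_indices N - ?B. A \<alpha>) + (\<Sum>\<alpha>\<in>?B. A \<alpha>)"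
    using B by (intro sum.subset_diff) auto
  ultimately show ?thesis
    using total[of N] by (simp add: A_def)
qed

text \<open>In each column one entry is determined by the others and the column sum. That column sum
  has only \<open>2 * w + 1\<close> possible values, while each remaining entry has at most
  \<open>M + w + 1\<close>.\<close>

lemma card_balanced_multi_indices_le:
  assumes w: "2 * real CARD('c) * real M < (real w + 1)\<^sup>2"
  shows "card (balanced_multi_indices M :: ('r::finite \<times> 'c::finite \<Rightarrow> nat) set)
    \<le> ((2 * w + 1) * (M + w + 1) ^ (CARD('r) - 1)) ^ CARD('c)"
proof -
  let ?B = "balanced_multi_indices M :: ('r \<times> 'c \<Rightarrow> nat) set"
  \<comment> \<open>An arbitrary row \<open>i0\<close>. The map \<open>g\<close> replaces its
    entries by the column sums and is still injective. Truncated subtraction in \<open>M - w\<close>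
    can only shrink the window.\<close>
  fix i0 :: 'r
  define S where "S = (\<lambda>p :: 'r \<times> 'c. if fst p = i0 then {M - w..M + w} else {..M + w})"
  define g where "g = (\<lambda>(\<alpha> :: 'r \<times> 'c \<Rightarrow> nat) p. if fst p = i0 then column_sum \<alpha> (snd p) else \<alpha> p)"
  have rem: "column_sum \<alpha> j = \<alpha> (i0, j) + (\<Sum>i\<in>UNIV - {i0}. \<alpha> (i, j))" for \<alpha> :: "'r \<times> 'c \<Rightarrow> nat" and j
    unfolding column_sum_def by (rule sum.remove) auto
  have "inj_on g ?B"
  proof (rule inj_onI, rule ext)
    fix \<alpha> \<beta> :: "'r \<times> 'c \<Rightarrow> nat" and p :: "'r \<times> 'c" assume "g \<alpha> = g \<beta>"
    then have g: "g \<alpha> q = g \<beta> q" for q by simp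
    obtain i j where p: "p = (i, j)" by (cases p)
    have off: "\<alpha> (i, j) = \<beta> (i, j)" if "i \<noteq> i0" for i
      using g[of "(i, j)"] that by (simp add: g_def)
    have "(\<Sum>i\<in>UNIV - {i0}. \<alpha> (i, j)) = (\<Sum>i\<in>UNIV - {i0}. \<beta> (i, j))"
      by (intro sum.cong) (auto simp: off)
    moreover have "column_sum \<alpha> j = column_sum \<beta> j"
      using g[of "(i0, j)"] by (simp add: g_def)
    ultimately have "\<alpha> (i0, j) = \<beta> (i0, j)" by (simp add: rem)
    with off show "\<alpha> p = \<beta> p" unfolding p by (cases "i = i0") auto
  qed
  moreover have "g ` ?B \<subseteq> PiE UNIV S"
  proof (clarsimp simp: PiE_def Pi_def)
    fix \<alpha> :: "'r \<times> 'c \<Rightarrow> nat" and i :: 'r and j :: 'c assume a: "\<alpha> \<in> ?B"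
    have "(real (column_sum \<alpha> j) - real M)\<^sup>2 < (real w + 1)\<^sup>2"
      using a w by (auto simp: balanced_multi_indices_def intro: order.strict_trans1)
    then have "\<bar>real (column_sum \<alpha> j) - real M\<bar> < real w + 1"
      using power2_less_imp_less[of "\<bar>real (column_sum \<alpha> j) - real M\<bar>" "real w + 1"] by simp
    \<comment> \<open>By integrality a deviation smaller than \<open>w + 1\<close> is at most
      \<open>w\<close>.\<close>
    then have c: "M - w \<le> column_sum \<alpha> j" "column_sum \<alpha> j \<le> M + w" by linarith+
    have "\<alpha> (i, j) \<le> column_sum \<alpha> j"
      unfolding column_sum_def by (intro member_le_sum) auto
    with c show "g \<alpha> (i, j) \<in> S (i, j)"
      by (auto simp: g_def S_def)
  qed
  ultimately have "card ?B \<le> card (PiE UNIV S)"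
    by (intro card_inj_on_le finite_PiE) (auto simp: S_def)
  also have "\<dots> = (\<Prod>p\<in>UNIV. card (S p))"
    by (rule card_PiE) simp
  also have "\<dots> \<le> (\<Prod>p\<in>(UNIV :: ('r \<times> 'c) set). if fst p = i0 then 2 * w + 1 else M + w + 1)"
    by (intro prod_mono) (auto simp: S_def)
  also have "\<dots> = (\<Prod>i\<in>(UNIV :: 'r set). \<Prod>j\<in>(UNIV :: 'c set). if i = i0 then 2 * w + 1 else M + w + 1)"
    using prod.cartesian_product[of "\<lambda>i _. if i = i0 then 2 * w + 1 else M + w + 1" "UNIV :: 'c set" "UNIV :: 'r set"]
    by (simp only: UNIV_Times_UNIV case_prod_unfold)
  also have "\<dots> = (\<Prod>i\<in>(UNIV :: 'r set). if i = i0 then 2 * w + 1 else M + w + 1) ^ CARD('c)"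
    by (simp only: prod_constant prod_power_distrib)
  also have "(\<Prod>i\<in>(UNIV :: 'r set). if i = i0 then 2 * w + 1 else M + w + 1) =
      (2 * w + 1) * (\<Prod>i\<in>UNIV - {i0}. M + w + 1)"
    by (subst prod.remove[of _ i0]) (auto intro!: prod.cong)
  also have "(\<Prod>i\<in>UNIV - {i0}. M + w + 1) = (M + w + 1) ^ (CARD('r) - 1)"
    by (simp only: prod_constant card_Diff_singleton[OF UNIV_I])
  finally show ?thesis .
qed

section \<open>Moments of Haar measure\<close>

lemma haar_prob_space: "is_haar \<mu> \<Longrightarrow> prob_space \<mu>"
  by (simp add: is_haar_def)

lemma haar_sets: "is_haar \<mu> \<Longrightarrow> sets \<mu> = sets borel"
  by (simp add: is_haar_def)

lemma haar_measurable:
  assumes "is_haar \<mu>" and "f \<in> borel_measurable borel"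
  shows "f \<in> borel_measurable \<mu>"
  using assms(2) measurable_cong_sets[OF haar_sets[OF assms(1)] refl, of borel] by auto

lemma haar_AE_unitary:
  assumes "is_haar \<mu>"
  shows "AE U in \<mu>. U \<in> unitary_mats"
proof -
  interpret prob_space \<mu> by (rule haar_prob_space[OF assms])
  have 1: "measure \<mu> unitary_mats = 1" using assms by (simp add: is_haar_def)
  \<comment> \<open>A set outside the sigma-algebra has \<open>measure\<close> zero, so the value 1
    already yields measurability.\<close>
  then have "unitary_mats \<in> sets \<mu>"
    using measure_notin_sets[of unitary_mats \<mu>] by auto
  then show ?thesis using prob_eq_1 1 by simp
qed

lemma haar_integrable:
  fixes f :: "complex^'n^'n \<Rightarrow> 'b::{banach, second_countable_topology}"
  assumes "is_haar \<mu>" "f \<in> borel_measurable borel" "\<And>U. U \<in> unitary_mats \<Longrightarrow> norm (f U) \<le> C"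
  shows "integrable \<mu> f"
proof -
  interpret prob_space \<mu> by (rule haar_prob_space[OF assms(1)])
  have "AE U in \<mu>. norm (f U) \<le> C"
    using haar_AE_unitary[OF assms(1)] by eventually_elim (rule assms(3))
  then show ?thesis
    by (rule integrable_const_bound) (rule haar_measurable[OF assms(1,2)])
qed

lemma borel_measurable_matrix_mult:
  fixes V :: "complex^'n^'n"
  shows "(\<lambda>U. V ** U) \<in> borel_measurable borel"
  by (intro borel_measurable_continuous_onI linear_continuous_on)
    (auto intro!: linear_conv_bounded_linear[THEN iffD1] linearI
      simp: vec_eq_iff matrix_matrix_mult_def algebra_simps sum.distrib scaleR_sum_right)

lemma haar_integral_mult:
  fixes f :: "complex^'n^'n \<Rightarrow> 'b::{banach, second_countable_topology}"
  assumes "is_haar \<mu>" "V \<in> unitary_mats" "f \<in> borel_measurable borel"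
  shows "(\<integral>U. f (V ** U) \<partial>\<mu>) = (\<integral>U. f U \<partial>\<mu>)"
proof -
  have "(\<integral>U. f U \<partial>\<mu>) = (\<integral>U. f U \<partial>distr \<mu> borel (\<lambda>U. V ** U))"
    using assms by (simp add: is_haar_def)
  also have "\<dots> = (\<integral>U. f (V ** U) \<partial>\<mu>)"
    by (rule integral_distr[OF haar_measurable[OF assms(1) borel_measurable_matrix_mult] assms(3)])
  finally show ?thesis ..
qed

section \<open>Moments of the normalised entries of a unitary matrix\<close>

lemma adjoint_mat_unitary: "V \<in> unitary_mats \<Longrightarrow> adjoint_mat V \<in> unitary_mats"
proof -
  have "adjoint_mat (adjoint_mat V) = V" by (simp add: adjoint_mat_def vec_eq_iff)
  then show "V \<in> unitary_mats \<Longrightarrow> adjoint_mat V \<in> unitary_mats"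
    by (simp add: unitary_mats_def)
qed

lemma unitary_column_norm:
  assumes "U \<in> unitary_mats"
  shows "(\<Sum>i\<in>UNIV. (cmod (U $ i $ j))\<^sup>2) = 1"
proof -
  have "(adjoint_mat U ** U) $ j $ j = 1"
    using assms by (simp add: unitary_mats_def mat_def)
  then have "(\<Sum>i\<in>UNIV. complex_of_real ((cmod (U $ i $ j))\<^sup>2)) = 1"
    by (simp only: matrix_matrix_mult_def adjoint_mat_def vec_lambda_beta complex_norm_square mult.commute)
  then show ?thesis
    by (metis of_real_eq_1_iff of_real_sum)
qed

lemma unitary_entry_le:
  assumes "U \<in> unitary_mats"
  shows "cmod (U $ i $ j) \<le> 1"
proof -
  have "(cmod (U $ i $ j))\<^sup>2 \<le> 1"
    unfolding unitary_column_norm[OF assms, of j, symmetric] by (intro member_le_sum) auto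
  then show ?thesis by (simp add: power_le_one_iff abs_square_le_1)
qed

text \<open>The scaling makes a unitary matrix a unit vector indexed by pairs (row, column), each
  column carrying weight \<open>1 / CARD('n)\<close>. The squared moduli are thus the cell
  probabilities needed in \<open>sum_balanced_multi_indices_ge\<close>.\<close>

definition unit_entries :: "complex^'n^'n \<Rightarrow> 'n \<times> 'n \<Rightarrow> complex" where
  "unit_entries U p = U $ fst p $ snd p / complex_of_real (sqrt (real CARD('n)))"

lemma norm_unit_entries_column:
  fixes U :: "complex^'n^'n"
  assumes "U \<in> unitary_mats"
  shows "(\<Sum>i\<in>UNIV. (cmod (unit_entries U (i, j)))\<^sup>2) = 1 / real CARD('n)"
  using unitary_column_norm[OF assms, of j]
  by (simp add: unit_entries_def norm_divide power_divide sum_divide_distrib[symmetric])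

lemma norm_unit_entries_le:
  assumes "U \<in> unitary_mats"
  shows "cmod (unit_entries U p) \<le> 1"
proof -
  have "cmod (unit_entries U p) \<le> cmod (U $ fst p $ snd p) / 1"
    unfolding unit_entries_def norm_divide by (intro divide_left_mono) (auto simp: Suc_leI)
  with unitary_entry_le[OF assms, of "fst p" "snd p"] show ?thesis by simp
qed

lemma norm_multi_power_le:
  fixes x :: "'i::finite \<Rightarrow> 'a::real_normed_field"
  assumes "\<And>i. norm (x i) \<le> 1"
  shows "norm (multi_power x \<alpha>) \<le> 1"
  unfolding multi_power_def prod_norm[symmetric] norm_power
  using assms by (intro prod_le_1) (auto intro: power_le_one)

lemma continuous_unit_entries: "continuous_on UNIV (\<lambda>U. multi_power (unit_entries U) \<alpha>)"
  unfolding multi_power_def unit_entries_def by (intro continuous_intros) auto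

definition haar_moment :: "(complex^'n^'n) measure \<Rightarrow> ('n \<times> 'n \<Rightarrow> nat) \<Rightarrow> ('n \<times> 'n \<Rightarrow> nat) \<Rightarrow> complex" where
  "haar_moment \<mu> \<alpha> \<beta> = (\<integral>U. multi_power (unit_entries U) \<alpha> * cnj (multi_power (unit_entries U) \<beta>) \<partial>\<mu>)"

lemma haar_moment_integrable:
  fixes \<mu> :: "(complex^'n^'n) measure"
  assumes "is_haar \<mu>"
  shows "integrable \<mu> (\<lambda>U. multi_power (unit_entries U) \<alpha> * cnj (multi_power (unit_entries U) \<beta>))"
proof (rule haar_integrable[OF assms])
  show "(\<lambda>U. multi_power (unit_entries U) \<alpha> * cnj (multi_power (unit_entries U) \<beta>)) \<in> borel_measurable borel"
    by (intro borel_measurable_continuous_onI continuous_intros continuous_unit_entries)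
  show "norm (multi_power (unit_entries U) \<alpha> * cnj (multi_power (unit_entries U) \<beta>)) \<le> 1"
    if "U \<in> unitary_mats" for U :: "complex^'n^'n"
    unfolding norm_mult complex_mod_cnj
    by (intro mult_le_one norm_multi_power_le norm_unit_entries_le that) auto
qed

text \<open>Insert the factor 1, written as the sum of the squared moduli of all normalised entries,
  under the integral. This is the hypothesis on \<open>T\<close> in
  \<open>multi_energy_Suc\<close>.\<close>

lemma haar_moment_raise:
  fixes \<mu> :: "(complex^'n^'n) measure"
  assumes "is_haar \<mu>"
  shows "haar_moment \<mu> \<alpha> \<beta> = (\<Sum>p\<in>UNIV. haar_moment \<mu> (multi_raise p \<alpha>) (multi_raise p \<beta>))"
proof -
  let ?f = "\<lambda>U. multi_power (unit_entries U) \<alpha> * cnj (multi_power (unit_entries U) \<beta>)"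
  have "(\<Sum>p\<in>UNIV. haar_moment \<mu> (multi_raise p \<alpha>) (multi_raise p \<beta>)) =
      (\<integral>U. (\<Sum>p\<in>UNIV. multi_power (unit_entries U) (multi_raise p \<alpha>) *
         cnj (multi_power (unit_entries U) (multi_raise p \<beta>))) \<partial>\<mu>)"
    unfolding haar_moment_def
    by (rule Bochner_Integration.integral_sum[symmetric]) (rule haar_moment_integrable[OF assms])
  also have "\<dots> = (\<integral>U. ?f U \<partial>\<mu>)"
  proof (rule integral_cong_AE)
    show "AE U in \<mu>. (\<Sum>p\<in>UNIV. multi_power (unit_entries U) (multi_raise p \<alpha>) *
         cnj (multi_power (unit_entries U) (multi_raise p \<beta>))) = ?f U"
      using haar_AE_unitary[OF assms]
    proof eventually_elim
      case (elim U)
      have "(\<Sum>p\<in>UNIV. (cmod (unit_entries U p))\<^sup>2) = 1"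
        by (simp add: sum_UNIV_prod norm_unit_entries_column[OF elim])
      then have "(\<Sum>p\<in>UNIV. unit_entries U p * cnj (unit_entries U p)) = 1"
        by (simp only: complex_norm_square[symmetric] of_real_sum[symmetric] of_real_1)
      then have "?f U = ?f U * (\<Sum>p\<in>UNIV. unit_entries U p * cnj (unit_entries U p))" by simp
      then show ?case
        by (simp add: multi_power_multi_raise sum_distrib_left mult_ac)
    qed
  qed (auto intro!: borel_measurable_integrable haar_moment_integrable[OF assms] borel_measurable_sum)
  finally show ?thesis by (simp add: haar_moment_def)
qed

section \<open>The trace overlap and two-sided bounds on its moments\<close>

definition trace_overlap :: "complex^'n^'n \<Rightarrow> real" where
  "trace_overlap U = (cmod (trace U / of_nat CARD('n)))\<^sup>2"

lemma continuous_trace: "continuous_on UNIV (trace :: complex^'n^'n \<Rightarrow> complex)"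
  unfolding trace_def by (intro continuous_intros)

lemma continuous_trace_overlap: "continuous_on UNIV (trace_overlap :: complex^'n^'n \<Rightarrow> real)"
  unfolding trace_overlap_def by (intro continuous_intros continuous_trace) auto

text \<open>The trace of a translate is the normalised Hilbert-Schmidt inner product of two
  matrices. Left invariance can therefore introduce a second, independent matrix.\<close>

lemma trace_overlap_adjoint_mult:
  fixes U V :: "complex^'n^'n"
  shows "trace (adjoint_mat V ** U) / of_nat CARD('n) = (\<Sum>p\<in>UNIV. unit_entries U p * cnj (unit_entries V p))"
proof -
  have s: "x / complex_of_real (sqrt (real CARD('n))) * (y / complex_of_real (sqrt (real CARD('n)))) =
      x * y / of_nat CARD('n)" for x y
    by (simp add: of_real_mult[symmetric] del: of_real_mult)
  have "unit_entries U (i, j) * cnj (unit_entries V (i, j)) = cnj (V $ i $ j) * U $ i $ j / of_nat CARD('n)" for i j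
    using s[of "U $ i $ j" "cnj (V $ i $ j)"] by (simp add: unit_entries_def mult.commute)
  then show ?thesis
    by (simp only: trace_def matrix_matrix_mult_def adjoint_mat_def sum_UNIV_prod vec_lambda_beta sum_divide_distrib)
qed

text \<open>Applying the multinomial theorem to the power of the inner product and to its conjugate
  separates the variables: every term is a monomial in \<open>U\<close> times a monomial in
  \<open>V\<close>, ready for separate integration.\<close>

lemma trace_overlap_power_expand:
  fixes U V :: "complex^'n^'n"
  shows "complex_of_real (trace_overlap (adjoint_mat V ** U) ^ N) =
    (\<Sum>\<alpha>\<in>multi_indices N. \<Sum>\<beta>\<in>multi_indices N. of_real (multinom \<alpha> * multinom \<beta>) *
      (multi_power (unit_entries U) \<alpha> * cnj (multi_power (unit_entries U) \<beta>)) *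
      cnj (multi_power (unit_entries V) \<alpha> * cnj (multi_power (unit_entries V) \<beta>)))"
proof -
  let ?x = "\<lambda>p. unit_entries U p * cnj (unit_entries V p)"
  have mp: "multi_power ?x \<alpha> = multi_power (unit_entries U) \<alpha> * cnj (multi_power (unit_entries V) \<alpha>)" for \<alpha>
    by (simp add: multi_power_def power_mult_distrib prod.distrib)
  have "complex_of_real (trace_overlap (adjoint_mat V ** U) ^ N) = (sum ?x UNIV) ^ N * cnj ((sum ?x UNIV) ^ N)"
  proof -
    have "complex_of_real (trace_overlap (adjoint_mat V ** U)) = sum ?x UNIV * cnj (sum ?x UNIV)"
      unfolding trace_overlap_def trace_overlap_adjoint_mult complex_norm_square ..
    then show ?thesis
      by (simp only: of_real_power power_mult_distrib complex_cnj_power)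
  qed
  also have "\<dots> = (\<Sum>\<alpha>\<in>multi_indices N. of_real (multinom \<alpha>) * multi_power ?x \<alpha>) *
      (\<Sum>\<beta>\<in>multi_indices N. of_real (multinom \<beta>) * cnj (multi_power ?x \<beta>))"
    by (subst (1 2) multinomial_theorem) simp
  also have "\<dots> = (\<Sum>\<alpha>\<in>multi_indices N. \<Sum>\<beta>\<in>multi_indices N.
      of_real (multinom \<alpha>) * multi_power ?x \<alpha> * (of_real (multinom \<beta>) * cnj (multi_power ?x \<beta>)))"
    by (simp add: sum_product)
  also have "\<dots> = (\<Sum>\<alpha>\<in>multi_indices N. \<Sum>\<beta>\<in>multi_indices N. of_real (multinom \<alpha> * multinom \<beta>) *
      (multi_power (unit_entries U) \<alpha> * cnj (multi_power (unit_entries U) \<beta>)) *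
      cnj (multi_power (unit_entries V) \<alpha> * cnj (multi_power (unit_entries V) \<beta>)))"
    by (intro sum.cong refl) (simp add: mp)
  finally show ?thesis .
qed

lemma trace_overlap_nonneg: "trace_overlap U \<ge> 0"
  by (simp add: trace_overlap_def)

lemma trace_overlap_le_1:
  fixes U :: "complex^'n^'n"
  assumes "U \<in> unitary_mats"
  shows "trace_overlap U \<le> 1"
proof -
  have "cmod (trace U) \<le> (\<Sum>i\<in>(UNIV::'n set). 1)"
    unfolding trace_def by (intro order.trans[OF norm_sum] sum_mono unitary_entry_le assms)
  then have "cmod (trace U / of_nat CARD('n)) \<le> 1"
    by (simp add: norm_divide)
  then show ?thesis by (simp add: trace_overlap_def power_le_one)
qed

lemma trace_overlap_integrable:
  fixes \<mu> :: "(complex^'n^'n) measure"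
  assumes "is_haar \<mu>"
  shows "integrable \<mu> (\<lambda>U. trace_overlap U ^ N)"
proof (rule haar_integrable[OF assms])
  show "(\<lambda>U :: complex^'n^'n. trace_overlap U ^ N) \<in> borel_measurable borel"
    by (intro borel_measurable_continuous_onI continuous_intros continuous_trace_overlap)
  show "norm (trace_overlap U ^ N) \<le> 1" if "U \<in> unitary_mats" for U :: "complex^'n^'n"
    using trace_overlap_nonneg[of U] trace_overlap_le_1[OF that] by (simp add: power_le_one)
qed

lemma integral_double_sum:
  fixes f :: "'a \<Rightarrow> 'b \<Rightarrow> 'c \<Rightarrow> complex"
  assumes "\<And>a b. integrable M (f a b)"
  shows "(\<integral>x. (\<Sum>a\<in>A. \<Sum>b\<in>B. c a b * f a b x) \<partial>M) = (\<Sum>a\<in>A. \<Sum>b\<in>B. c a b * (\<integral>x. f a b x \<partial>M))"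
  using assms by (simp add: Bochner_Integration.integral_sum Bochner_Integration.integrable_sum)

text \<open>By left invariance the second copy of the moments may be averaged over as well.\<close>
lemma trace_overlap_moment_eq:
  fixes \<mu> :: "(complex^'n^'n) measure"
  assumes "is_haar \<mu>"
  shows "(\<integral>U. trace_overlap U ^ N \<partial>\<mu>) = multi_energy (haar_moment \<mu>) N"
proof -
  interpret prob_space \<mu> by (rule haar_prob_space[OF assms])
  define m where "m V \<alpha> \<beta> = multi_power (unit_entries V) \<alpha> * cnj (multi_power (unit_entries V) \<beta>)"
    for V :: "complex^'n^'n" and \<alpha> \<beta>
  have m_int: "integrable \<mu> (\<lambda>U. m U \<alpha> \<beta>)" for \<alpha> \<beta>
    unfolding m_def by (rule haar_moment_integrable[OF assms])
  have m_eq: "(\<integral>U. m U \<alpha> \<beta> \<partial>\<mu>) = haar_moment \<mu> \<alpha> \<beta>" for \<alpha> \<beta>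
    unfolding m_def haar_moment_def ..
  let ?e = "complex_of_real (\<integral>U. trace_overlap U ^ N \<partial>\<mu>)"
  let ?g = "\<lambda>V. \<Sum>\<alpha>\<in>multi_indices N. \<Sum>\<beta>\<in>multi_indices N.
      (of_real (multinom \<alpha> * multinom \<beta>) * haar_moment \<mu> \<alpha> \<beta>) * cnj (m V \<alpha> \<beta>)"
  have e: "?e = ?g V" if V: "V \<in> unitary_mats" for V
  proof -
    have "?e = (\<integral>U. complex_of_real (trace_overlap U ^ N) \<partial>\<mu>)"
      by (rule integral_complex_of_real[symmetric])
    also have "\<dots> = (\<integral>U. complex_of_real (trace_overlap (adjoint_mat V ** U) ^ N) \<partial>\<mu>)"
      by (intro haar_integral_mult[OF assms adjoint_mat_unitary[OF V], symmetric]
        borel_measurable_continuous_onI continuous_intros continuous_trace_overlap)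
    also have "\<dots> = (\<integral>U. (\<Sum>\<alpha>\<in>multi_indices N. \<Sum>\<beta>\<in>multi_indices N.
        (of_real (multinom \<alpha> * multinom \<beta>) * cnj (m V \<alpha> \<beta>)) * m U \<alpha> \<beta>) \<partial>\<mu>)"
      unfolding trace_overlap_power_expand m_def
      by (intro Bochner_Integration.integral_cong refl sum.cong) (simp only: mult_ac)
    also have "\<dots> = (\<Sum>\<alpha>\<in>multi_indices N. \<Sum>\<beta>\<in>multi_indices N.
        (of_real (multinom \<alpha> * multinom \<beta>) * cnj (m V \<alpha> \<beta>)) * haar_moment \<mu> \<alpha> \<beta>)"
      unfolding m_eq[symmetric] by (rule integral_double_sum[OF m_int])
    also have "\<dots> = ?g V"
      by (intro sum.cong refl) (simp only: mult_ac)
    finally show ?thesis .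
  qed
  \<comment> \<open>The identity \<open>e\<close> holds for every unitary \<open>V\<close> and its
    left side is constant, so integrating over \<open>V\<close> turns the second monomial into the
    conjugate of the same moment.\<close>
  have "?e = (\<integral>V. ?e \<partial>\<mu>)"
    by (simp add: prob_space)
  also have "\<dots> = (\<integral>V. ?g V \<partial>\<mu>)"
  proof (rule integral_cong_AE)
    show "AE V in \<mu>. ?e = ?g V"
      using haar_AE_unitary[OF assms] by eventually_elim (rule e)
    show "?g \<in> borel_measurable \<mu>"
      by (intro borel_measurable_integrable Bochner_Integration.integrable_sum integrable_mult_right integrable_cnj m_int)
  qed simp
  also have "\<dots> = (\<Sum>\<alpha>\<in>multi_indices N. \<Sum>\<beta>\<in>multi_indices N.
      (of_real (multinom \<alpha> * multinom \<beta>) * haar_moment \<mu> \<alpha> \<beta>) * (\<integral>V. cnj (m V \<alpha> \<beta>) \<partial>\<mu>))"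
    by (rule integral_double_sum) (intro integrable_cnj m_int)
  also have "\<dots> = complex_of_real (multi_energy (haar_moment \<mu>) N)"
    by (simp only: Bochner_Integration.integral_cnj m_eq multi_energy_def of_real_sum of_real_mult mult.assoc complex_norm_square)
  finally show ?thesis by (simp only: of_real_eq_iff)
qed

text \<open>The diagonal moments, weighted by \<open>multinom\<close>, sum over the balanced indices
  to at least \<open>1 / 2\<close>, and their squares are part of the energy. Cauchy-Schwarz then
  gives \<open>1 / 4\<close> at most the number of balanced indices times the moment; whence the
  factor 4.\<close>

lemma trace_overlap_moment_ge:
  fixes \<mu> :: "(complex^'n^'n) measure"
  assumes haar: "is_haar \<mu>" and "M > 0" and w: "2 * real CARD('n) * real M < (real w + 1)\<^sup>2"
  shows "1 \<le> 4 * ((2 * real w + 1) * (real M + real w + 1) ^ (CARD('n) - 1)) ^ CARD('n) *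
    (\<integral>U. trace_overlap U ^ (CARD('n) * M) \<partial>\<mu>)"
proof -
  interpret prob_space \<mu> by (rule haar_prob_space[OF haar])
  let ?B = "balanced_multi_indices M :: ('n \<times> 'n \<Rightarrow> nat) set"
  let ?N = "CARD('n) * M"
  have B: "?B \<subseteq> multi_indices ?N" by (auto simp: balanced_multi_indices_def)
  then have fin: "finite ?B" by (rule finite_subset) simp
  define x where "x U p = (cmod (unit_entries U p))\<^sup>2" for U :: "complex^'n^'n" and p
  \<comment> \<open>On the diagonal the integrand is a monomial in the squared moduli, hence real
    and nonnegative.\<close>
  have x_eq: "multi_power (unit_entries U) \<alpha> * cnj (multi_power (unit_entries U) \<alpha>) =
      complex_of_real (multi_power (x U) \<alpha>)" for U \<alpha>
    by (simp add: multi_power_def x_def prod.distrib[symmetric] power_mult_distrib[symmetric]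
        complex_norm_square[symmetric] flip: of_real_power)
  have int: "integrable \<mu> (\<lambda>U. multi_power (x U) \<alpha>)" for \<alpha>
    using haar_moment_integrable[OF haar, of \<alpha> \<alpha>] unfolding x_eq by (simp add: complex_of_real_integrable_eq)
  have T: "haar_moment \<mu> \<alpha> \<alpha> = complex_of_real (\<integral>U. multi_power (x U) \<alpha> \<partial>\<mu>)" for \<alpha>
    unfolding haar_moment_def x_eq by (rule integral_complex_of_real)
  define t where "t \<alpha> = multinom \<alpha> * (\<integral>U. multi_power (x U) \<alpha> \<partial>\<mu>)" for \<alpha>
  have "1 / 2 = (\<integral>U. (1 / 2 :: real) \<partial>\<mu>)" by (simp add: prob_space)
  also have "\<dots> \<le> (\<integral>U. (\<Sum>\<alpha>\<in>?B. multinom \<alpha> * multi_power (x U) \<alpha>) \<partial>\<mu>)"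
  proof (rule integral_mono_AE)
    show "AE U in \<mu>. 1 / 2 \<le> (\<Sum>\<alpha>\<in>?B. multinom \<alpha> * multi_power (x U) \<alpha>)"
      using haar_AE_unitary[OF haar]
    proof eventually_elim
      case (elim U)
      show ?case
        by (rule sum_balanced_multi_indices_ge) (use elim \<open>M > 0\<close> in \<open>auto simp: x_def norm_unit_entries_column\<close>)
    qed
  qed (auto intro!: Bochner_Integration.integrable_sum integrable_mult_right int)
  also have "\<dots> = (\<Sum>\<alpha>\<in>?B. t \<alpha>)"
    unfolding t_def by (subst Bochner_Integration.integral_sum) (auto intro!: integrable_mult_right int)
  finally have half: "1 / 2 \<le> (\<Sum>\<alpha>\<in>?B. t \<alpha>)" .
  \<comment> \<open>All terms of the energy are nonnegative, so unbalanced and off-diagonal ones may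
    be dropped.\<close>
  have "(\<Sum>\<alpha>\<in>?B. (t \<alpha>)\<^sup>2) = (\<Sum>\<alpha>\<in>?B. multinom \<alpha> * multinom \<alpha> * (cmod (haar_moment \<mu> \<alpha> \<alpha>))\<^sup>2)"
    by (simp add: t_def T power2_eq_square abs_mult_self_eq mult_ac)
  also have "\<dots> \<le> (\<Sum>\<alpha>\<in>multi_indices ?N. multinom \<alpha> * multinom \<alpha> * (cmod (haar_moment \<mu> \<alpha> \<alpha>))\<^sup>2)"
    using multinom_pos by (intro sum_mono2 B) (auto intro: less_imp_le)
  also have "\<dots> \<le> multi_energy (haar_moment \<mu>) ?N"
    unfolding multi_energy_def
  proof (intro sum_mono)
    fix \<alpha> :: "'n \<times> 'n \<Rightarrow> nat" assume "\<alpha> \<in> multi_indices ?N"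
    then show "multinom \<alpha> * multinom \<alpha> * (cmod (haar_moment \<mu> \<alpha> \<alpha>))\<^sup>2 \<le>
      (\<Sum>\<beta>\<in>multi_indices ?N. multinom \<alpha> * multinom \<beta> * (cmod (haar_moment \<mu> \<alpha> \<beta>))\<^sup>2)"
      using multinom_pos by (intro member_le_sum mult_nonneg_nonneg) (auto intro: less_imp_le)
  qed
  finally have energy: "(\<Sum>\<alpha>\<in>?B. (t \<alpha>)\<^sup>2) \<le> (\<integral>U. trace_overlap U ^ ?N \<partial>\<mu>)"
    by (simp add: trace_overlap_moment_eq[OF haar])
  have "(1 / 2)\<^sup>2 \<le> (\<Sum>\<alpha>\<in>?B. t \<alpha>)\<^sup>2"
    using half by (intro power_mono) auto
  also have "\<dots> = (\<Sum>\<alpha>\<in>?B. 1 * t \<alpha>)\<^sup>2" by simp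
  also have "\<dots> \<le> (\<Sum>\<alpha>\<in>?B. 1\<^sup>2) * (\<Sum>\<alpha>\<in>?B. (t \<alpha>)\<^sup>2)"
    by (rule Cauchy_Schwarz_ineq_sum)
  also have "\<dots> \<le> real (((2 * w + 1) * (M + w + 1) ^ (CARD('n) - 1)) ^ CARD('n)) * (\<integral>U. trace_overlap U ^ ?N \<partial>\<mu>)"
    using card_balanced_multi_indices_le[OF w, where 'r = 'n]
    by (intro mult_mono energy sum_nonneg) (simp_all del: of_nat_power of_nat_mult)
  also have "real (((2 * w + 1) * (M + w + 1) ^ (CARD('n) - 1)) ^ CARD('n)) =
      ((2 * real w + 1) * (real M + real w + 1) ^ (CARD('n) - 1)) ^ CARD('n)"
    by (simp only: of_nat_power of_nat_mult of_nat_add of_nat_1 of_nat_numeral)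
  finally show ?thesis
    by (simp only: power_divide power_one) simp
qed

section \<open>Truncated Chebyshev expansion of a power\<close>

text \<open>The shifted Chebyshev polynomials: \<open>double_angle_poly n\<close> at
  \<open>z\<close> is the \<open>n\<close>-th Chebyshev polynomial at \<open>2 * z - 1\<close>,
  which is \<open>cos (2 * x)\<close> for \<open>z\<close> the square of
  \<open>cos x\<close>.\<close>

fun double_angle_poly :: "nat \<Rightarrow> real poly" where
  "double_angle_poly 0 = 1"
| "double_angle_poly (Suc 0) = [:-1, 2:]"
| "double_angle_poly (Suc (Suc n)) = [:-2, 4:] * double_angle_poly (Suc n) - double_angle_poly n"

lemma degree_double_angle_poly: "degree (double_angle_poly n) \<le> n"
proof (induction n rule: double_angle_poly.induct)
  case (3 n)
  have "degree ([:-2, 4:] * double_angle_poly (Suc n)) \<le> Suc (Suc n)"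
    using degree_mult_le[of "[:-2, 4:]" "double_angle_poly (Suc n)"] 3 by simp
  with 3 show ?case by (auto intro: degree_diff_le)
qed auto

lemma poly_double_angle_poly: "poly (double_angle_poly n) ((cos x)\<^sup>2) = cos (2 * real n * x)"
proof (induction n rule: double_angle_poly.induct)
  case 2
  show ?case using cos_double_cos[of x] by simp
next
  case (3 n)
  have "2 * real (Suc (Suc n)) * x = 2 * real (Suc n) * x + 2 * x" "2 * real n * x = 2 * real (Suc n) * x - 2 * x"
    by (simp_all add: algebra_simps)
  then have "cos (2 * real (Suc (Suc n)) * x) + cos (2 * real n * x) = 2 * cos (2 * x) * cos (2 * real (Suc n) * x)"
    by (simp only: cos_add cos_diff) simp
  moreover have "poly (double_angle_poly (Suc (Suc n))) ((cos x)\<^sup>2) =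
      2 * cos (2 * x) * cos (2 * real (Suc n) * x) - cos (2 * real n * x)"
    using 3 by (simp add: cos_double_cos left_diff_distrib)
  ultimately show ?case by linarith
qed simp

text \<open>Binomial expansion of the sum of \<open>cis x\<close> and \<open>cis (- x)\<close>, real
  parts taken. The absolute value makes every frequency the index of a polynomial
  \<open>double_angle_poly\<close>.\<close>

lemma cos_power_even:
  "(cos x) ^ (2 * N) = (\<Sum>l\<le>2 * N. real ((2 * N) choose l) / 4 ^ N * cos (2 * \<bar>real l - real N\<bar> * x))"
proof -
  have "complex_of_real (2 * cos x) = cis x + cis (- x)"
    by (simp add: complex_eq_iff)
  then have "complex_of_real ((2 * cos x) ^ (2 * N)) = (cis x + cis (- x)) ^ (2 * N)"
    by (simp only: of_real_power)
  also have "\<dots> = (\<Sum>l\<le>2 * N. of_nat ((2 * N) choose l) * cis (2 * (real l - real N) * x))"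
    unfolding binomial_ring
  proof (intro sum.cong refl)
    fix l assume "l \<in> {..2 * N}"
    then have "real l * x + real (2 * N - l) * (- x) = 2 * (real l - real N) * x"
      by (simp add: of_nat_diff algebra_simps)
    then have "cis x ^ l * cis (- x) ^ (2 * N - l) = cis (2 * (real l - real N) * x)"
      by (simp only: Complex.DeMoivre cis_mult)
    then show "of_nat ((2 * N) choose l) * cis x ^ l * cis (- x) ^ (2 * N - l) =
        of_nat ((2 * N) choose l) * cis (2 * (real l - real N) * x)"
      by (simp only: mult.assoc)
  qed
  finally have "(2 * cos x) ^ (2 * N) =
      Re (\<Sum>l\<le>2 * N. of_nat ((2 * N) choose l) * cis (2 * (real l - real N) * x))"
    by (metis Re_complex_of_real)
  also have "\<dots> = (\<Sum>l\<le>2 * N. real ((2 * N) choose l) * cos (2 * \<bar>real l - real N\<bar> * x))"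
    unfolding Re_sum
  proof (intro sum.cong refl)
    fix l
    have "cos (2 * (real l - real N) * x) = cos (2 * \<bar>real l - real N\<bar> * x)"
      using cos_minus[of "2 * (real l - real N) * x"]
      by (cases "real l \<ge> real N") (simp_all add: abs_if del: cos_minus, simp add: algebra_simps del: cos_minus)
    then show "Re (of_nat ((2 * N) choose l) * cis (2 * (real l - real N) * x)) =
        real ((2 * N) choose l) * cos (2 * \<bar>real l - real N\<bar> * x)"
      by simp
  qed
  also have "(2 * cos x) ^ (2 * N) = 4 ^ N * cos x ^ (2 * N)"
    by (simp add: power_mult_distrib power_mult)
  finally have "cos x ^ (2 * N) = (\<Sum>l\<le>2 * N. real ((2 * N) choose l) * cos (2 * \<bar>real l - real N\<bar> * x)) / 4 ^ N"
    by (simp add: eq_divide_eq mult.commute)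
  then show ?thesis
    by (simp add: sum_divide_distrib)
qed

text \<open>The expansion \<open>cos_power_even\<close>, with frequencies above \<open>k\<close>
  removed. The coefficients are the probabilities of a symmetric binomial distribution with
  \<open>2 * N\<close> trials.\<close>

definition truncated_power :: "nat \<Rightarrow> nat \<Rightarrow> real poly" where
  "truncated_power N k = (\<Sum>l | l \<le> 2 * N \<and> \<bar>real l - real N\<bar> \<le> real k.
     smult (real ((2 * N) choose l) / 4 ^ N) (double_angle_poly (nat \<bar>int l - int N\<bar>)))"

lemma degree_truncated_power: "degree (truncated_power N k) \<le> k"
  unfolding truncated_power_def
proof (intro degree_sum_le)
  fix l assume "l \<in> {l. l \<le> 2 * N \<and> \<bar>real l - real N\<bar> \<le> real k}"
  then have "nat \<bar>int l - int N\<bar> \<le> k" by auto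
  then show "degree (smult (real ((2 * N) choose l) / 4 ^ N) (double_angle_poly (nat \<bar>int l - int N\<bar>))) \<le> k"
    by (intro order.trans[OF degree_smult_le] order.trans[OF degree_double_angle_poly])
qed simp

text \<open>Hoeffding's inequality for \<open>2 * N\<close> fair coin tosses, whose mean is
  \<open>N\<close>.\<close>

lemma central_binomial_tail:
  assumes "N > 0"
  shows "(\<Sum>l | l \<le> 2 * N \<and> real k < \<bar>real l - real N\<bar>. real ((2 * N) choose l) / 4 ^ N)
    \<le> 2 * exp (- ((real k)\<^sup>2 / real N))"
proof -
  interpret binomial_distribution "2 * N" "1 / 2" by unfold_locales simp
  let ?A = "{l. l \<le> 2 * N \<and> real k < \<bar>real l - real N\<bar>}"
  have fin: "finite ?A" by simp
  have "(\<Sum>l\<in>?A. real ((2 * N) choose l) / 4 ^ N) = (\<Sum>l\<in>?A. pmf (binomial_pmf (2 * N) (1 / 2)) l)"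
  proof (intro sum.cong refl)
    fix l assume "l \<in> ?A"
    then have "(1 / 2 :: real) ^ l * (1 / 2) ^ (2 * N - l) = (1 / 4) ^ N"
      by (simp add: power_add[symmetric] power_mult power2_eq_square)
    then show "real ((2 * N) choose l) / 4 ^ N = pmf (binomial_pmf (2 * N) (1 / 2)) l"
      by (simp add: mult.assoc power_one_over field_simps)
  qed
  also have "\<dots> = measure_pmf.prob (binomial_pmf (2 * N) (1 / 2)) ?A"
    by (rule measure_measure_pmf_finite[OF fin, symmetric])
  also have "\<dots> \<le> measure_pmf.prob (binomial_pmf (2 * N) (1 / 2)) {l. \<bar>real l - real (2 * N) * (1 / 2)\<bar> \<ge> real k}"
    by (intro measure_pmf.finite_measure_mono) auto
  also have "\<dots> \<le> 2 * exp (- 2 * (real k)\<^sup>2 / real (2 * N))"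
    using assms by (intro prob_abs_ge) auto
  finally show ?thesis by simp
qed

text \<open>Every \<open>z\<close> in the unit interval is the square of some \<open>cos x\<close>.
  Each removed term is at most its coefficient, so the error is at most the binomial tail.\<close>

lemma truncated_power_error:
  assumes "N > 0" "0 \<le> z" "z \<le> 1"
  shows "\<bar>poly (truncated_power N k) z - z ^ N\<bar> \<le> 2 * exp (- ((real k)\<^sup>2 / real N))"
proof -
  define x where "x = arccos (sqrt z)"
  have cx: "(cos x)\<^sup>2 = z"
  proof -
    have "cos x = sqrt z"
      unfolding x_def by (rule cos_arccos) (use assms real_sqrt_ge_zero[of z] in \<open>auto intro: order.trans[of _ 0]\<close>)
    then show ?thesis using assms by simp
  qed
  let ?c = "\<lambda>l. real ((2 * N) choose l) / 4 ^ N" and ?f = "\<lambda>l. cos (2 * \<bar>real l - real N\<bar> * x)"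
  let ?K = "{l. l \<le> 2 * N \<and> \<bar>real l - real N\<bar> \<le> real k}"
  have "poly (truncated_power N k) z = (\<Sum>l\<in>?K. ?c l * ?f l)"
    unfolding truncated_power_def poly_sum
  proof (intro sum.cong refl)
    fix l
    have "real (nat \<bar>int l - int N\<bar>) = \<bar>real l - real N\<bar>" by simp
    then show "poly (smult (?c l) (double_angle_poly (nat \<bar>int l - int N\<bar>))) z = ?c l * ?f l"
      unfolding cx[symmetric] by (simp add: poly_double_angle_poly)
  qed
  moreover have "z ^ N = (\<Sum>l\<le>2 * N. ?c l * ?f l)"
    using cos_power_even[of x N] by (simp add: power_mult cx)
  moreover have "(\<Sum>l\<le>2 * N. ?c l * ?f l) = (\<Sum>l\<in>{..2 * N} - ?K. ?c l * ?f l) + (\<Sum>l\<in>?K. ?c l * ?f l)"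
    by (intro sum.subset_diff) auto
  ultimately have "\<bar>poly (truncated_power N k) z - z ^ N\<bar> = \<bar>\<Sum>l\<in>{..2 * N} - ?K. ?c l * ?f l\<bar>"
    by simp
  also have "\<dots> \<le> (\<Sum>l\<in>{..2 * N} - ?K. ?c l)"
  proof (intro order.trans[OF sum_abs] sum_mono)
    fix l
    have "?c l * \<bar>?f l\<bar> \<le> ?c l * 1"
      by (intro mult_left_mono abs_cos_le_one) simp
    then show "\<bar>?c l * ?f l\<bar> \<le> ?c l" by (simp add: abs_mult)
  qed
  also have "{..2 * N} - ?K = {l. l \<le> 2 * N \<and> real k < \<bar>real l - real N\<bar>}"
    by auto
  finally show ?thesis
    using central_binomial_tail[OF assms(1), of k] by linarith
qed

section \<open>Balanced polynomials\<close>

lemma balanced_poly_cong: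
  assumes "balanced_poly t f" "\<And>U. U \<in> unitary_mats \<Longrightarrow> g U = f U"
  shows "balanced_poly t g"
  using assms(1) unfolding balanced_poly_def by (simp add: assms(2) cong: ball_cong)

lemma balanced_poly_const: "balanced_poly t (\<lambda>_. c)"
  unfolding balanced_poly_def
  by (intro exI[of _ 1] exI[of _ "\<lambda>_. c"] exI[of _ "\<lambda>_. 0"]) auto

lemma balanced_poly_cmult:
  assumes "balanced_poly t f"
  shows "balanced_poly t (\<lambda>U. b * f U)"
proof -
  obtain N :: nat and c s i j k l where f: "\<forall>m<N. s m \<le> t" "\<forall>U\<in>unitary_mats. f U = (\<Sum>m<N. c m *
      (\<Prod>a<s m. U $ i m a $ j m a * cnj (U $ k m a $ l m a)))"
    using assms unfolding balanced_poly_def by blast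
  show ?thesis
    unfolding balanced_poly_def
    by (rule exI[of _ N], rule exI[of _ "\<lambda>m. b * c m"], rule exI[of _ s], rule exI[of _ i],
      rule exI[of _ j], rule exI[of _ k], rule exI[of _ l])
      (use f in \<open>auto simp: sum_distrib_left mult.assoc\<close>)
qed

lemma balanced_poly_add:
  assumes "balanced_poly t f" "balanced_poly t g"
  shows "balanced_poly t (\<lambda>U. f U + g U)"
proof -
  obtain N :: nat and c s i j k l where f: "\<forall>m<N. s m \<le> t" "\<forall>U\<in>unitary_mats. f U = (\<Sum>m<N. c m *
      (\<Prod>a<s m. U $ i m a $ j m a * cnj (U $ k m a $ l m a)))"
    using assms(1) unfolding balanced_poly_def by blast
  obtain N' :: nat and c' s' i' j' k' l' where g: "\<forall>m<N'. s' m \<le> t" "\<forall>U\<in>unitary_mats. g U = (\<Sum>m<N'. c' m *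
      (\<Prod>a<s' m. U $ i' m a $ j' m a * cnj (U $ k' m a $ l' m a)))"
    using assms(2) unfolding balanced_poly_def by blast
  \<comment> \<open>The two lists of terms are concatenated: terms from \<open>N\<close> onwards are
    those of \<open>g\<close>, shifted by \<open>N\<close>.\<close>
  define ci where "ci m = (if m < N then c m else c' (m - N))" for m
  define si where "si m = (if m < N then s m else s' (m - N))" for m
  define ii where "ii m = (if m < N then i m else i' (m - N))" for m
  define ji where "ji m = (if m < N then j m else j' (m - N))" for m
  define ki where "ki m = (if m < N then k m else k' (m - N))" for m
  define li where "li m = (if m < N then l m else l' (m - N))" for m
  have split: "(\<Sum>m<N + N'. h m) = (\<Sum>m<N. h m) + (\<Sum>m<N'. h (m + N))" for h :: "nat \<Rightarrow> complex"
    by (induction N') (auto simp: add.commute add.left_commute)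
  show ?thesis
    unfolding balanced_poly_def
  proof (rule exI[of _ "N + N'"], rule exI[of _ ci], rule exI[of _ si], rule exI[of _ ii],
      rule exI[of _ ji], rule exI[of _ ki], rule exI[of _ li], intro conjI ballI allI impI)
    show "si m \<le> t" if "m < N + N'" for m
      using f(1) g(1) that by (auto simp: si_def)
    show "f U + g U = (\<Sum>m<N + N'. ci m * (\<Prod>a<si m. U $ ii m a $ ji m a * cnj (U $ ki m a $ li m a)))"
      if "U \<in> unitary_mats" for U
      using f(2) g(2) that unfolding split
      by (auto simp: ci_def si_def ii_def ji_def ki_def li_def intro!: arg_cong2[where f = "(+)"] sum.cong)
  qed
qed

lemma balanced_poly_sum:
  assumes "\<And>x. x \<in> A \<Longrightarrow> balanced_poly t (f x)"
  shows "balanced_poly t (\<lambda>U. \<Sum>x\<in>A. f x U)"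
  using assms
proof (induction A rule: infinite_finite_induct)
  case (insert x A)
  then show ?case by (simp add: balanced_poly_add)
qed (simp_all add: balanced_poly_const)

lemma balanced_poly_mult_entries:
  assumes "balanced_poly t f"
  shows "balanced_poly (Suc t) (\<lambda>U. f U * (U $ p $ q * cnj (U $ r $ v)))"
proof -
  obtain N :: nat and c s i j k l where f: "\<forall>m<N. s m \<le> t" "\<forall>U\<in>unitary_mats. f U = (\<Sum>m<N. c m *
      (\<Prod>a<s m. U $ i m a $ j m a * cnj (U $ k m a $ l m a)))"
    using assms unfolding balanced_poly_def by blast
  show ?thesis
    unfolding balanced_poly_def
  \<comment> \<open>The new pair of entries is stored at position \<open>s m\<close>, just behind
    the factors of the \<open>m\<close>-th term.\<close>
  proof (rule exI[of _ N], rule exI[of _ c], rule exI[of _ "\<lambda>m. Suc (s m)"],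
      rule exI[of _ "\<lambda>m. (i m)(s m := p)"], rule exI[of _ "\<lambda>m. (j m)(s m := q)"],
      rule exI[of _ "\<lambda>m. (k m)(s m := r)"], rule exI[of _ "\<lambda>m. (l m)(s m := v)"], intro conjI ballI allI impI)
    fix U :: "complex^'a^'a" assume "U \<in> unitary_mats"
    with f(2) show "f U * (U $ p $ q * cnj (U $ r $ v)) = (\<Sum>m<N. c m * (\<Prod>a<Suc (s m).
        U $ ((i m)(s m := p)) a $ ((j m)(s m := q)) a * cnj (U $ ((k m)(s m := r)) a $ ((l m)(s m := v)) a)))"
      by (simp add: sum_distrib_right mult.assoc)
  qed (use f(1) in auto)
qed

text \<open>The squared modulus of the trace is the sum of all products of a diagonal entry with a
  conjugated diagonal entry, so it raises the balanced degree by one.\<close>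

lemma balanced_poly_trace_overlap_mult:
  fixes f :: "complex^'n^'n \<Rightarrow> complex"
  assumes "balanced_poly t f"
  shows "balanced_poly (Suc t) (\<lambda>U. complex_of_real (trace_overlap U) * f U)"
proof (rule balanced_poly_cong)
  show "balanced_poly (Suc t) (\<lambda>U. \<Sum>a\<in>UNIV. \<Sum>b\<in>UNIV. 1 / (of_nat CARD('n))\<^sup>2 * (f U * (U $ a $ a * cnj (U $ b $ b))))"
    by (intro balanced_poly_sum balanced_poly_cmult balanced_poly_mult_entries assms)
  fix U :: "complex^'n^'n"
  have "complex_of_real (trace_overlap U) = (\<Sum>a\<in>UNIV. \<Sum>b\<in>UNIV. U $ a $ a * cnj (U $ b $ b)) / (of_nat CARD('n))\<^sup>2"
    unfolding trace_overlap_def complex_norm_square by (simp add: trace_def sum_product power2_eq_square)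
  then show "complex_of_real (trace_overlap U) * f U =
      (\<Sum>a\<in>UNIV. \<Sum>b\<in>UNIV. 1 / (of_nat CARD('n))\<^sup>2 * (f U * (U $ a $ a * cnj (U $ b $ b))))"
    by (simp add: sum_distrib_left[symmetric] sum_divide_distrib[symmetric] mult.commute)
qed

text \<open>Induction along Horner's scheme, each multiplication by \<open>trace_overlap\<close>
  using up one degree.\<close>

lemma balanced_poly_poly_trace_overlap:
  fixes p :: "real poly"
  assumes "degree p \<le> k"
  shows "balanced_poly k (\<lambda>U :: complex^'n^'n. complex_of_real (poly p (trace_overlap U)))"
  using assms
proof (induction p arbitrary: k)
  case 0
  then show ?case by (simp add: balanced_poly_const)
next
  case (pCons a p)
  show ?case
  proof (cases "p = 0")
    case True
    then show ?thesis by (simp add: balanced_poly_const)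
  next
    case False
    then obtain k' where k': "k = Suc k'" "degree p \<le> k'"
      using pCons.prems by (cases k) (auto simp: degree_pCons_eq)
    have "balanced_poly k (\<lambda>U :: complex^'n^'n. complex_of_real a +
        complex_of_real (trace_overlap U) * complex_of_real (poly p (trace_overlap U)))"
      unfolding k'(1) by (intro balanced_poly_add balanced_poly_const balanced_poly_trace_overlap_mult pCons.IH k'(2))
    then show ?thesis by simp
  qed
qed

section \<open>Channel distance and trace\<close>

text \<open>The norm of the matrix type is the Frobenius norm; Cauchy-Schwarz is applied to each
  row.\<close>

lemma norm_matrix_vector_mult_le:
  fixes A :: "complex^'n^'m"
  shows "norm (A *v x) \<le> norm A * norm x"
proof -
  have "(norm (A *v x))\<^sup>2 = (\<Sum>i\<in>UNIV. (cmod (\<Sum>j\<in>UNIV. A $ i $ j * x $ j))\<^sup>2)"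
    by (simp add: norm_vec_def L2_set_def sum_nonneg matrix_vector_mult_def)
  also have "\<dots> \<le> (\<Sum>i\<in>UNIV. (norm (A $ i))\<^sup>2 * (norm x)\<^sup>2)"
  proof (intro sum_mono)
    fix i
    have "(cmod (\<Sum>j\<in>UNIV. A $ i $ j * x $ j))\<^sup>2 \<le> (\<Sum>j\<in>UNIV. cmod (A $ i $ j) * cmod (x $ j))\<^sup>2"
      by (intro power_mono order.trans[OF norm_sum]) (auto simp: norm_mult)
    also have "\<dots> \<le> (\<Sum>j\<in>UNIV. (cmod (A $ i $ j))\<^sup>2) * (\<Sum>j\<in>UNIV. (cmod (x $ j))\<^sup>2)"
      by (rule Cauchy_Schwarz_ineq_sum)
    also have "\<dots> = (norm (A $ i))\<^sup>2 * (norm x)\<^sup>2"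
      by (simp add: norm_vec_def L2_set_def sum_nonneg)
    finally show "(cmod (\<Sum>j\<in>UNIV. A $ i $ j * x $ j))\<^sup>2 \<le> (norm (A $ i))\<^sup>2 * (norm x)\<^sup>2" .
  qed
  also have "\<dots> = (norm A * norm x)\<^sup>2"
    by (simp add: norm_vec_def L2_set_def sum_nonneg power_mult_distrib sum_distrib_right)
  finally show ?thesis
    by (rule power2_le_imp_le) simp
qed

lemma opnorm_le_norm: "opnorm A \<le> norm A"
  unfolding opnorm_def by (rule onorm_bound) (auto intro: norm_matrix_vector_mult_le)

lemma opnorm_nonneg: "opnorm A \<ge> 0"
proof -
  have "bounded_linear ((*v) A)"
  proof (rule bounded_linear_intro[where K = "norm A"])
    show "A *v (x + y) = A *v x + A *v y" for x y
      by (rule matrix_vector_right_distrib)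
    show "A *v (r *\<^sub>R x) = r *\<^sub>R (A *v x)" for r x
      by (simp add: vec_eq_iff matrix_vector_mult_def scaleR_sum_right)
    show "norm (A *v x) \<le> norm x * norm A" for x
      using norm_matrix_vector_mult_le[of A x] by (simp only: mult.commute)
  qed
  then show ?thesis unfolding opnorm_def by (rule onorm_pos_le)
qed

text \<open>The Frobenius distance to the phase of the trace bounds the channel distance from above.\<close>
lemma trace_overlap_le_of_chan_dist:
  fixes U :: "complex^'n^'n"
  assumes U: "U \<in> unitary_mats" and \<epsilon>: "0 \<le> \<epsilon>" "\<epsilon> < chan_dist U (mat 1)"
  shows "sqrt (trace_overlap U) \<le> 1 - \<epsilon>\<^sup>2 / (2 * real CARD('n))"
proof -
  \<comment> \<open>The phase of the trace, taken in the interval over which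
    \<open>chan_dist\<close> forms its infimum. If the trace vanishes, any phase serves.\<close>
  obtain \<phi> where \<phi>: "0 \<le> \<phi>" "\<phi> < 2 * pi" "trace U = of_real (cmod (trace U)) * cis \<phi>"
    using Arg2pi[of "trace U"] unfolding is_Arg_def cis_conv_exp[symmetric] by blast
  define A where "A = U - (\<chi> a b. cis \<phi> * (mat 1 :: complex^'n^'n) $ a $ b)"
  have "chan_dist U (mat 1) \<le> opnorm A"
    unfolding chan_dist_def A_def using \<phi>
    by (intro cINF_lower bdd_belowI2[where m = 0]) (auto intro: opnorm_nonneg)
  also have "\<dots> \<le> norm A" by (rule opnorm_le_norm)
  finally have "\<epsilon>\<^sup>2 \<le> (norm A)\<^sup>2"
    using \<epsilon> by (intro power_mono) auto
  also have "(norm A)\<^sup>2 = (\<Sum>i\<in>UNIV. \<Sum>j\<in>UNIV. (cmod (A $ i $ j))\<^sup>2)"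
    by (simp add: norm_vec_def L2_set_def sum_nonneg)
  also have "\<dots> = (\<Sum>i\<in>UNIV. \<Sum>j\<in>UNIV. (cmod (U $ i $ j))\<^sup>2 +
      (if i = j then 1 - 2 * Re (U $ i $ j * cnj (cis \<phi>)) else 0))"
  proof (intro sum.cong refl)
    fix i j
    have "(cmod (z - cis \<phi>))\<^sup>2 = (cmod z)\<^sup>2 + (1 - 2 * Re (z * cnj (cis \<phi>)))" for z
      by (simp add: cmod_power2 power2_diff cos_squared_eq algebra_simps)
    then show "(cmod (A $ i $ j))\<^sup>2 = (cmod (U $ i $ j))\<^sup>2 +
      (if i = j then 1 - 2 * Re (U $ i $ j * cnj (cis \<phi>)) else 0)"
      by (simp add: A_def mat_def)
  qed
  also have "\<dots> = (\<Sum>j\<in>UNIV. \<Sum>i\<in>UNIV. (cmod (U $ i $ j))\<^sup>2) +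
      (\<Sum>i\<in>UNIV. 1 - 2 * Re (U $ i $ i * cnj (cis \<phi>)))"
    by (subst sum.swap) (simp add: sum.distrib)
  \<comment> \<open>The unit columns contribute \<open>CARD('n)\<close>, and so does the scaled
    identity; the cross term is removed by aligning the phase with the trace.\<close>
  also have "\<dots> = 2 * real CARD('n) - 2 * Re (trace U * cnj (cis \<phi>))"
    by (simp only: unitary_column_norm[OF U] sum_subtractf sum_distrib_left[symmetric] Re_sum[symmetric]
        sum_distrib_right[symmetric] trace_def) simp
  also have "trace U * cnj (cis \<phi>) = of_real (cmod (trace U))"
    by (subst \<phi>(3)) (simp add: mult.assoc cis_mult cis_cnj)
  finally have "cmod (trace U) \<le> real CARD('n) - \<epsilon>\<^sup>2 / 2" by simp
  then have "cmod (trace U) / real CARD('n) \<le> (real CARD('n) - \<epsilon>\<^sup>2 / 2) / real CARD('n)"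
    by (intro divide_right_mono) auto
  then show ?thesis
    by (simp add: trace_overlap_def norm_divide diff_divide_distrib mult.commute)
qed

section \<open>The approximate delta kernel\<close>

text \<open>With \<open>s = 1 / \<sigma>^2\<close>, the parameter \<open>M\<close> is about
  \<open>s\<close> and \<open>w\<close> at most of order \<open>sqrt (d * s)\<close>, so each column
  contributes at most a constant times \<open>s ^ (d - 1) * sqrt s\<close>. The factor 36 is the 4
  of \<open>trace_overlap_moment_ge\<close> times a reserve of 9 for the norm bound.\<close>

lemma lower_bound_numerics:
  fixes \<sigma> :: real and d M w :: nat
  assumes d: "d \<ge> 2" and \<sigma>: "0 < \<sigma>" "\<sigma>\<^sup>2 * (36 * real d) \<le> 1"
    and M: "real M \<le> 25 / 24 / \<sigma>\<^sup>2" and w: "real w \<le> sqrt (2 * real d * real M)"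
  shows "36 * ((2 * real w + 1) * (real M + real w + 1) ^ (d - 1)) ^ d
    \<le> 64 * 4 ^ (d\<^sup>2) * (1 / \<sigma>\<^sup>2) ^ (d\<^sup>2 - d) * (1 / \<sigma>) ^ d"
proof -
  define s where "s = 1 / \<sigma>\<^sup>2"
  have s: "36 * real d \<le> s" "s > 0"
    using \<sigma> by (simp_all add: s_def field_simps)
  have s72: "72 \<le> s" using s d by simp
  have M': "real M \<le> 25 / 24 * s" using M by (simp add: s_def)
  have dM: "2 * real d * real M \<le> 2 * real d * (25 / 24 * s)"
    using M' d by (intro mult_left_mono) auto
  also have "\<dots> \<le> 2 * (s / 36) * (25 / 24 * s)"
    using s by (intro mult_right_mono mult_left_mono) auto
  also have "\<dots> \<le> (s / 4)\<^sup>2"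
    using s by (simp add: power2_eq_square)
  finally have "sqrt (2 * real d * real M) \<le> s / 4"
    using s by (intro real_le_lsqrt) auto
  then have A: "real M + real w + 1 \<le> 4 / 3 * s"
    using w M' s72 by linarith
  \<comment> \<open>The constant \<open>29 / 20\<close> is a rational upper bound for the square
    root of \<open>25 / 12\<close>. It leaves room to absorb the \<open>+ 1\<close> below, since
    \<open>sqrt (d * s)\<close> is at least 10.\<close>
  have "2 * real d * real M \<le> (29 / 20)\<^sup>2 * (real d * s)"
    using dM s d by (simp add: power2_eq_square)
  then have "sqrt (2 * real d * real M) \<le> sqrt ((29 / 20)\<^sup>2 * (real d * s))"
    by (rule real_sqrt_le_mono)
  also have "\<dots> = 29 / 20 * (sqrt (real d) * sqrt s)"
    by (simp add: real_sqrt_mult)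
  finally have w': "real w \<le> 29 / 20 * (sqrt (real d) * sqrt s)"
    using w by linarith
  have "10\<^sup>2 \<le> real d * s"
    using mult_mono[of 2 "real d" 72 s] d s72 by simp
  then have "10 \<le> sqrt (real d) * sqrt s"
    unfolding real_sqrt_mult[symmetric] by (rule real_le_rsqrt)
  with w' have B: "2 * real w + 1 \<le> 3 * (sqrt (real d) * sqrt s)" by linarith
  have sq: "sqrt s = 1 / \<sigma>"
    using \<sigma> by (simp add: s_def real_sqrt_divide)
  \<comment> \<open>All constants of one column fit into \<open>4 ^ d\<close>; the \<open>d\<close>
    columns together then give 4 to the power \<open>d * d\<close>.\<close>
  have small: "3 * sqrt (real d) * (4 / 3) ^ (d - 1) \<le> 4 ^ d"
  proof -
    have "sqrt (real d) \<le> real d"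
      using d by (intro real_le_lsqrt) (auto simp: power2_eq_square)
    also have "\<dots> \<le> 2 ^ d"
      by (metis less_exp less_imp_le of_nat_le_iff of_nat_numeral of_nat_power)
    finally have "3 * sqrt (real d) * (4 / 3) ^ (d - 1) \<le> 3 * 2 ^ d * (4 / 3) ^ (d - 1)"
      by (intro mult_right_mono mult_left_mono) auto
    also have "\<dots> = 6 * (8 / 3) ^ (d - 1)"
      using d by (cases d) (auto simp: power_mult_distrib[symmetric])
    also have "\<dots> \<le> 4 * 4 ^ (d - 1)"
    proof -
      obtain e where e: "d = Suc (Suc e)"
        using d by (metis add_2_eq_Suc le_Suc_ex)
      have "(8 / 3 :: real) ^ e \<le> 4 ^ e" by (intro power_mono) auto
      then show ?thesis by (simp add: e)
    qed
    also have "\<dots> = 4 ^ d" using d by (cases d) auto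
    finally show ?thesis .
  qed
  have "(2 * real w + 1) * (real M + real w + 1) ^ (d - 1) \<le>
      3 * (sqrt (real d) * sqrt s) * (4 / 3 * s) ^ (d - 1)"
    by (intro mult_mono power_mono A B) (use s in auto)
  also have "\<dots> = (3 * sqrt (real d) * (4 / 3) ^ (d - 1)) * (s ^ (d - 1) * (1 / \<sigma>))"
    by (simp only: sq power_mult_distrib mult_ac)
  also have "\<dots> \<le> 4 ^ d * (s ^ (d - 1) * (1 / \<sigma>))"
    using s \<sigma> by (intro mult_right_mono small) auto
  finally have "((2 * real w + 1) * (real M + real w + 1) ^ (d - 1)) ^ d \<le> (4 ^ d * (s ^ (d - 1) * (1 / \<sigma>))) ^ d"
    by (intro power_mono) auto
  also have "\<dots> = 4 ^ (d * d) * (s ^ ((d - 1) * d) * (1 / \<sigma>) ^ d)"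
    by (simp only: power_mult_distrib power_mult)
  also have "(d - 1) * d = d\<^sup>2 - d"
    by (simp add: power2_eq_square diff_mult_distrib)
  finally have "((2 * real w + 1) * (real M + real w + 1) ^ (d - 1)) ^ d \<le>
      4 ^ d\<^sup>2 * s ^ (d\<^sup>2 - d) * (1 / \<sigma>) ^ d"
    by (simp add: power2_eq_square mult.assoc)
  moreover have "0 \<le> 4 ^ d\<^sup>2 * s ^ (d\<^sup>2 - d) * (1 / \<sigma>) ^ d"
    using s \<sigma> by simp
  moreover have "64 * 4 ^ d\<^sup>2 * s ^ (d\<^sup>2 - d) * (1 / \<sigma>) ^ d = 64 * (4 ^ d\<^sup>2 * s ^ (d\<^sup>2 - d) * (1 / \<sigma>) ^ d)"
    by (simp only: mult.assoc)
  ultimately show ?thesis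
    unfolding s_def[symmetric] by linarith
qed

text \<open>Each base on the left is at most a power of \<open>1 / \<sigma>\<close>, because
  \<open>1 / \<sigma>\<close> is at least 3. The right side is the logarithmic part of the
  truncation exponent, so the truncation error is small even relative to the moment.\<close>

lemma bound_le_exp:
  fixes \<sigma> :: real and d :: nat
  assumes d: "d \<ge> 2" and \<sigma>: "0 < \<sigma>" "3 * \<sigma> \<le> 1"
  shows "4 * (64 * 4 ^ (d\<^sup>2) * (1 / \<sigma>\<^sup>2) ^ (d\<^sup>2 - d) * (1 / \<sigma>) ^ d) \<le> exp (24 * (real d)\<^sup>2 * ln (1 / \<sigma>))"
proof -
  define L where "L = ln (1 / \<sigma>)"
  have expL: "exp L = 1 / \<sigma>" using \<sigma> by (simp add: L_def)
  have "3 \<le> 1 / \<sigma>"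
    using \<sigma> by (simp add: field_simps)
  with exp_le have "exp 1 \<le> 1 / \<sigma>" by (rule order.trans)
  then have L: "1 \<le> L" using \<sigma> by (simp add: L_def ln_ge_iff)
  have d2: "1 \<le> (real d)\<^sup>2"
    using d by (simp add: power2_eq_square) (metis Suc_1 Suc_leD mult_le_mono mult_1 of_nat_1 of_nat_le_iff of_nat_mult One_nat_def)
  have s: "1 / \<sigma>\<^sup>2 = exp (2 * L)" 
    using expL by (simp add: exp_double power_one_over)
  have "d \<le> d\<^sup>2" by (simp add: power2_eq_square)
  have "(1 / \<sigma>) ^ d \<le> (1 / \<sigma>\<^sup>2) ^ d"
    unfolding s expL[symmetric] using L by (intro power_mono) auto
  then have "(1 / \<sigma>\<^sup>2) ^ (d\<^sup>2 - d) * (1 / \<sigma>) ^ d \<le> (1 / \<sigma>\<^sup>2) ^ (d\<^sup>2 - d) * (1 / \<sigma>\<^sup>2) ^ d"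
    by (intro mult_left_mono) auto
  also have "\<dots> = (1 / \<sigma>\<^sup>2) ^ (d\<^sup>2)"
    using \<open>d \<le> d\<^sup>2\<close> by (simp add: power_add[symmetric] del: power_one_over)
  also have "\<dots> = exp (2 * L) ^ (d\<^sup>2)" by (simp only: s)
  finally have 1: "(1 / \<sigma>\<^sup>2) ^ (d\<^sup>2 - d) * (1 / \<sigma>) ^ d \<le> exp (2 * L) ^ (d\<^sup>2)" .
  have two: "2 \<le> exp L" using L exp_ge_add_one_self[of L] by linarith
  have four: "4 \<le> exp (2 * L)"
    using mult_mono[OF two two] by (simp add: exp_double power2_eq_square)
  have "4 * (64 * 4 ^ (d\<^sup>2) * (1 / \<sigma>\<^sup>2) ^ (d\<^sup>2 - d) * (1 / \<sigma>) ^ d) =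
      4 ^ 4 * (4 ^ (d\<^sup>2) * ((1 / \<sigma>\<^sup>2) ^ (d\<^sup>2 - d) * (1 / \<sigma>) ^ d))"
    by simp
  also have "\<dots> \<le> exp (2 * L) ^ 4 * (exp (2 * L) ^ (d\<^sup>2) * exp (2 * L) ^ (d\<^sup>2))"
    by (intro mult_mono power_mono four 1) (use \<sigma> in auto)
  also have "\<dots> = exp (8 * L + 4 * (real d)\<^sup>2 * L)"
    by (simp add: exp_of_nat_mult[symmetric] exp_add[symmetric] algebra_simps)
  also have "\<dots> \<le> exp (24 * (real d)\<^sup>2 * L)"
  proof -
    have "1 * L \<le> (real d)\<^sup>2 * L" using L d2 by (intro mult_right_mono) auto
    then show ?thesis using L by simp
  qed
  finally show ?thesis unfolding L_def .
qed

text \<open>Split the exponent \<open>d * d - 1\<close> into \<open>d * (d - 1)\<close> and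
  \<open>d - 1\<close>. The first part is covered by \<open>3 < pi\<close>, the second by
  \<open>exp (y2 / 12)\<close>, which is exactly the gap between \<open>y2 / 3\<close> and
  \<open>y2 / 4\<close>.\<close>

lemma three_halves_power_le:
  fixes d :: nat and y2 :: real
  assumes "d \<ge> 2" and "36 * real d \<le> y2"
  shows "exp (- (y2 / 3)) * (3 / 2) ^ (d * d - 1) \<le> exp (- (y2 / 4)) * (pi / 2) ^ (d * (d - 1))"
proof -
  have d: "d * d - 1 = d * (d - 1) + (d - 1)"
    using assms(1) by (cases d) auto
  have "(3 / 2 :: real) ^ (d - 1) \<le> exp 1 ^ (d - 1)"
    using exp_ge_add_one_self[of 1] by (intro power_mono) auto
  also have "\<dots> \<le> exp (y2 / 12)"
    using assms by (simp add: exp_of_nat_mult[symmetric] of_nat_diff)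
  finally have "(3 / 2 :: real) ^ (d * (d - 1)) * (3 / 2) ^ (d - 1) \<le> (pi / 2) ^ (d * (d - 1)) * exp (y2 / 12)"
    using pi_gt3 by (intro mult_mono power_mono) auto
  then have "exp (- (y2 / 3)) * (3 / 2) ^ (d * d - 1) \<le> exp (- (y2 / 3)) * ((pi / 2) ^ (d * (d - 1)) * exp (y2 / 12))"
    unfolding d power_add by (intro mult_left_mono) auto
  also have "\<dots> = (exp (- (y2 / 3)) * exp (y2 / 12)) * (pi / 2) ^ (d * (d - 1))"
    by simp
  also have "exp (- (y2 / 3)) * exp (y2 / 12) = exp (- (y2 / 4))"
    by (simp add: exp_add[symmetric])
  finally show ?thesis .
qed

text \<open>The squared threshold for \<open>k\<close> carries the factor 25, and \<open>N\<close>
  at most \<open>25 / 24\<close> times \<open>d / \<sigma>^2\<close> turns it into 24. The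
  coefficient \<open>1/8\<close> under the root then becomes 3.\<close>

lemma truncation_exponent_ge:
  fixes d k N :: nat and \<epsilon> \<sigma> :: real
  assumes d: "d \<ge> 1" and \<sigma>: "0 < \<sigma>" "\<sigma> \<le> 1" and N: "0 < N" "real N \<le> real d * (25 / 24 / \<sigma>\<^sup>2)"
    and k: "real k \<ge> 5 * (real d powr (3/2) / \<sigma>) * sqrt (1/8 * (\<epsilon>^2 / (real d ^ 2 * \<sigma>^2)) + ln (1/\<sigma>))"
  shows "(real k)\<^sup>2 / real N \<ge> 3 * (\<epsilon>\<^sup>2 / \<sigma>\<^sup>2) + 24 * (real d)\<^sup>2 * ln (1 / \<sigma>)"
proof -
  define A where "A = 1/8 * (\<epsilon>^2 / (real d ^ 2 * \<sigma>^2)) + ln (1/\<sigma>)"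
  have "A \<ge> 0" using \<sigma> by (simp add: A_def)
  have d3: "(real d powr (3/2))\<^sup>2 = real d ^ 3"
    using d by (simp add: powr_power)
  have "(5 * (real d powr (3/2) / \<sigma>) * sqrt A)\<^sup>2 \<le> (real k)\<^sup>2"
    using k \<sigma> unfolding A_def[symmetric] by (intro power_mono) (use \<open>A \<ge> 0\<close> in auto)
  also have "(5 * (real d powr (3/2) / \<sigma>) * sqrt A)\<^sup>2 = 25 * (real d ^ 3 / \<sigma>\<^sup>2) * A"
    using \<open>A \<ge> 0\<close> by (simp add: power_mult_distrib power_divide d3)
  also have "\<dots> = (24 * (real d)\<^sup>2 * A) * (real d * (25 / 24 / \<sigma>\<^sup>2))"
    by (simp add: power3_eq_cube power2_eq_square)
  finally have "(24 * (real d)\<^sup>2 * A) * (real d * (25 / 24 / \<sigma>\<^sup>2)) \<le> (real k)\<^sup>2" .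
  moreover have "(24 * (real d)\<^sup>2 * A) * real N \<le> (24 * (real d)\<^sup>2 * A) * (real d * (25 / 24 / \<sigma>\<^sup>2))"
    using \<open>A \<ge> 0\<close> by (intro mult_left_mono N) auto
  ultimately have "24 * (real d)\<^sup>2 * A \<le> (real k)\<^sup>2 / real N"
    using N by (simp add: pos_le_divide_eq)
  also have "24 * (real d)\<^sup>2 * A = 3 * (\<epsilon>\<^sup>2 / \<sigma>\<^sup>2) + 24 * (real d)\<^sup>2 * ln (1 / \<sigma>)"
    using d \<sigma> by (simp add: A_def field_simps)
  finally show ?thesis .
qed

text \<open>On the complement of the ball one third of the exponent pays for the Gaussian factor,
  the remaining two thirds are compared with the full moment.\<close>
lemma trace_overlap_power_tail:
  fixes U :: "complex^'n^'n"
  assumes U: "U \<in> unitary_mats" and \<epsilon>: "0 < \<epsilon>" "\<epsilon> \<le> 1" "\<epsilon> < chan_dist U (mat 1)"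
  shows "trace_overlap U ^ (3 * (CARD('n) * r)) \<le> exp (- (\<epsilon>\<^sup>2 * real r)) * trace_overlap U ^ (2 * (CARD('n) * r))"
proof -
  define d where "d = real CARD('n)"
  have d: "d \<ge> 1" by (simp add: d_def Suc_leI)
  define q where "q = CARD('n) * r"
  have "sqrt (trace_overlap U) \<le> 1 - \<epsilon>\<^sup>2 / (2 * d)"
    using trace_overlap_le_of_chan_dist[OF U] \<epsilon> by (simp add: d_def)
  also have "\<dots> \<le> exp (- (\<epsilon>\<^sup>2 / (2 * d)))"
    using exp_ge_add_one_self[of "- (\<epsilon>\<^sup>2 / (2 * d))"] by simp
  \<comment> \<open>The exponent is chosen so that \<open>\<epsilon>^2 / (2 * d)\<close> times
    \<open>2 * q\<close> is \<open>\<epsilon>^2 * r\<close>.\<close>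
  finally have "sqrt (trace_overlap U) ^ (2 * q) \<le> exp (- (\<epsilon>\<^sup>2 / (2 * d))) ^ (2 * q)"
    by (intro power_mono) (auto simp: trace_overlap_nonneg)
  also have "\<dots> = exp (- (\<epsilon>\<^sup>2 * real r))"
    using d by (simp add: exp_of_nat_mult[symmetric] q_def d_def)
  also have "sqrt (trace_overlap U) ^ (2 * q) = trace_overlap U ^ q"
    by (simp add: power_mult trace_overlap_nonneg)
  finally have "trace_overlap U ^ q * trace_overlap U ^ (2 * q) \<le> exp (- (\<epsilon>\<^sup>2 * real r)) * trace_overlap U ^ (2 * q)"
    by (intro mult_right_mono) (auto simp: trace_overlap_nonneg)
  then show ?thesis
    unfolding q_def[symmetric] by (simp add: power_add[symmetric])
qed

text \<open>Above the threshold for \<open>k\<close> a single kernel \<open>P / p\<close> meets all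
  bounds: \<open>P\<close> differs from the \<open>N\<close>-th power of the overlap by at most
  \<open>\<eta>\<close>, a small fraction of its mean \<open>e\<close>, so that \<open>p\<close> is
  at least \<open>e / 2\<close>. The tail follows from the comparison of moments, the norm from the
  lower bound on \<open>e\<close>.\<close>

lemma approximate_delta_exists:
  fixes \<mu> :: "(complex^'n^'n) measure" and d k :: nat and \<epsilon> \<sigma> :: real
  assumes d_def: "d = CARD('n)" and d2: "d \<ge> 2" and haar: "is_haar \<mu>"
    and eps: "0 < \<epsilon>" "\<epsilon> \<le> 1" and sig: "0 < \<sigma>" "\<sigma> \<le> \<epsilon> / (6 * sqrt d)"
    and k: "real k \<ge> 5 * (real d powr (3/2) / \<sigma>) * sqrt (1/8 * (\<epsilon>^2 / (real d ^ 2 * \<sigma>^2)) + ln (1/\<sigma>))"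
  obtains F :: "complex^'n^'n \<Rightarrow> real" where
    "integrable \<mu> F" "(\<integral>U. F U \<partial>\<mu>) = 1"
    "(\<integral>\<^sup>+ U \<in> {U \<in> unitary_mats. chan_dist U (mat 1) > \<epsilon>}. ennreal \<bar>F U\<bar> \<partial>\<mu>)
      \<le> ennreal (9 * exp (- (\<epsilon>^2 / (4 * \<sigma>^2))) * (pi / 2) ^ (d * (d - 1)))"
    "balanced_poly k (\<lambda>U. complex_of_real (F U))"
    "(\<integral>\<^sup>+ U. ennreal (\<bar>F U\<bar>^2) \<partial>\<mu>) \<le> ennreal (64 * 4 ^ (d\<^sup>2) * (1 / \<sigma>\<^sup>2) ^ (d\<^sup>2 - d) * (1 / \<sigma>) ^ d)"
proof -
  interpret prob_space \<mu> by (rule haar_prob_space[OF haar])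
  define X where "X = 64 * 4 ^ (d\<^sup>2) * (1 / \<sigma>\<^sup>2) ^ (d\<^sup>2 - d) * (1 / \<sigma>) ^ d"
  define y2 where "y2 = \<epsilon>\<^sup>2 / \<sigma>\<^sup>2"
  have "6 * sqrt d * \<sigma> \<le> \<epsilon>"
    using sig d2 by (simp add: field_simps)
  then have "(6 * sqrt d * \<sigma>)\<^sup>2 \<le> \<epsilon>\<^sup>2"
    using sig by (intro power_mono) auto
  then have ds: "\<sigma>\<^sup>2 * (36 * real d) \<le> \<epsilon>\<^sup>2"
    by (simp add: power_mult_distrib mult_ac)
  also have "\<epsilon>\<^sup>2 \<le> 1" using eps by (simp add: power_le_one)
  finally have ds1: "\<sigma>\<^sup>2 * (36 * real d) \<le> 1" .
  have y2: "36 * real d \<le> y2"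
    using ds sig by (simp add: y2_def field_simps)
  have s72: "72 \<le> 1 / \<sigma>\<^sup>2"
  proof -
    have "\<sigma>\<^sup>2 * (36 * 2) \<le> \<sigma>\<^sup>2 * (36 * real d)"
      using d2 by (intro mult_left_mono) auto
    with ds1 have "\<sigma>\<^sup>2 * (36 * 2) \<le> 1" by (rule order.trans[rotated])
    then show ?thesis using sig by (simp add: field_simps)
  qed
  have \<sigma>3: "3 * \<sigma> \<le> 1"
  proof (rule power2_le_imp_le)
    show "(3 * \<sigma>)\<^sup>2 \<le> 1\<^sup>2"
      using s72 sig by (simp add: field_simps power_mult_distrib)
  qed simp
  \<comment> \<open>\<open>N = 3 * d * r\<close> is about \<open>d / \<sigma>^2\<close>.
    Divisibility by 3 makes two thirds of \<open>N\<close> an integer, and divisibility by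
    \<open>d\<close> makes the mean column sum \<open>M\<close> an integer. Rounding adds at most 3
    to \<open>M\<close>, which \<open>s72\<close> absorbs into the factor
    \<open>25 / 24\<close>.\<close>
  define r where "r = nat \<lceil>1 / (3 * \<sigma>\<^sup>2)\<rceil>"
  have "1 / (3 * \<sigma>\<^sup>2) > 0" using sig by simp
  then have r: "1 / (3 * \<sigma>\<^sup>2) \<le> real r" "real r \<le> 1 / (3 * \<sigma>\<^sup>2) + 1" "r > 0"
    unfolding r_def by linarith+
  define M where "M = 3 * r"
  define q where "q = CARD('n) * r"
  define N where "N = CARD('n) * M"
  have Nq: "N = 3 * q" by (simp add: N_def M_def q_def)
  have Npos: "N > 0" using r by (simp add: N_def M_def)
  have M: "real M \<le> 25 / 24 / \<sigma>\<^sup>2"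
    using r s72 by (simp add: M_def field_simps)
  define w where "w = nat \<lfloor>sqrt (2 * real d * real M)\<rfloor>"
  have w: "real w \<le> sqrt (2 * real d * real M)" "sqrt (2 * real d * real M) < real w + 1"
    unfolding w_def by (simp_all add: of_nat_floor) 
  then have w': "2 * real d * real M < (real w + 1)\<^sup>2"
    using power_strict_mono[OF w(2), of 2] by simp
  define e where "e = (\<integral>U. trace_overlap U ^ N \<partial>\<mu>)"
  have e1: "1 \<le> 4 * ((2 * real w + 1) * (real M + real w + 1) ^ (d - 1)) ^ d * e"
    using trace_overlap_moment_ge[OF haar, of M w] w' r unfolding d_def e_def N_def by (simp add: M_def)
  have e_pos: "e > 0"
  proof (rule ccontr)
    assume "\<not> e > 0"
    then have "4 * ((2 * real w + 1) * (real M + real w + 1) ^ (d - 1)) ^ d * e \<le> 0"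
      by (intro mult_nonneg_nonpos) auto
    with e1 show False by linarith
  qed
  \<comment> \<open>The reserve of 9 is consumed in the final norm estimate, where
    \<open>2 * e + \<eta>^2\<close> is at most \<open>9 * e / 4\<close>.\<close>
  have eX: "9 \<le> X * e"
  proof -
    have "9 \<le> 36 * ((2 * real w + 1) * (real M + real w + 1) ^ (d - 1)) ^ d * e" using e1 by linarith
    also have "\<dots> \<le> X * e"
      unfolding X_def using e_pos
      by (intro mult_right_mono lower_bound_numerics d2 sig ds1 M w) simp
    finally show ?thesis .
  qed
  have e_le: "e \<le> 1"
  proof -
    have "e \<le> (\<integral>U. 1 \<partial>\<mu>)"
      unfolding e_def
    proof (rule integral_mono_AE)
      show "AE U in \<mu>. trace_overlap U ^ N \<le> 1"
        using haar_AE_unitary[OF haar] by eventually_elim (simp add: trace_overlap_le_1 trace_overlap_nonneg power_le_one)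
    qed (auto intro: trace_overlap_integrable[OF haar])
    then show ?thesis by (simp add: prob_space)
  qed
  define \<eta> where "\<eta> = 2 * exp (- ((real k)\<^sup>2 / real N))"
  \<comment> \<open>The factor \<open>e / 2\<close> protects the normalisation \<open>p\<close>; the
    Gaussian factor lets the truncation error fit into the tail bound. Both come from
    \<open>bound_le_exp\<close> together with \<open>1 / X\<close> being at most
    \<open>e\<close>.\<close>
  have eta: "\<eta> \<le> e / 2 * exp (- (y2 / 4))"
  proof -
    have "real N \<le> real d * (25 / 24 / \<sigma>\<^sup>2)"
      unfolding N_def d_def of_nat_mult by (intro mult_left_mono M) simp
    then have "3 * y2 + 24 * (real d)\<^sup>2 * ln (1 / \<sigma>) \<le> (real k)\<^sup>2 / real N"
      unfolding y2_def
      by (intro truncation_exponent_ge[OF _ _ _ Npos _ k]) (use d2 sig \<sigma>3 in auto)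
    then have "\<eta> \<le> 2 * exp (- (3 * y2 + 24 * (real d)\<^sup>2 * ln (1 / \<sigma>)))"
      by (simp add: \<eta>_def)
    also have "\<dots> = 2 * exp (- (3 * y2)) / exp (24 * (real d)\<^sup>2 * ln (1 / \<sigma>))"
      by (simp add: exp_diff exp_minus field_simps exp_add)
    also have "\<dots> \<le> 2 * exp (- (3 * y2)) / (4 * X)"
      using bound_le_exp[OF d2 sig(1) \<sigma>3] sig unfolding X_def
      by (intro divide_left_mono mult_pos_pos) auto
    also have "\<dots> \<le> 2 * exp (- (y2 / 4)) / (4 * X)"
      using y2 sig by (intro divide_right_mono) (auto simp: X_def)
    also have "\<dots> \<le> e / 2 * exp (- (y2 / 4))"
    proof -
      have "X > 0" using sig by (simp add: X_def)
      then have "1 / X \<le> e" using eX by (simp add: field_simps)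
      then have "1 / X * exp (- (y2 / 4)) \<le> e * exp (- (y2 / 4))" by (intro mult_right_mono) auto
      then show ?thesis by simp
    qed
    finally show ?thesis .
  qed
  have eta_pos: "\<eta> > 0" by (simp add: \<eta>_def)
  have eta_e: "\<eta> \<le> e / 2"
  proof -
    have "e / 2 * exp (- (y2 / 4)) \<le> e / 2 * 1"
      using e_pos y2 by (intro mult_left_mono) auto
    with eta show ?thesis by simp
  qed
  define P where "P U = poly (truncated_power N k) (trace_overlap U)" for U :: "complex^'n^'n"
  have P_err: "\<bar>P U - trace_overlap U ^ N\<bar> \<le> \<eta>" if "U \<in> unitary_mats" for U
    unfolding P_def \<eta>_def
    by (intro truncated_power_error Npos trace_overlap_nonneg trace_overlap_le_1 that)
  have P_abs: "\<bar>P U\<bar> \<le> trace_overlap U ^ N + \<eta>" if "U \<in> unitary_mats" for U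
    using P_err[OF that] zero_le_power[OF trace_overlap_nonneg[of U], of N] by linarith
  have "P \<in> borel_measurable borel"
    unfolding P_def
    by (intro borel_measurable_continuous_onI continuous_intros continuous_trace_overlap)
  then have P_int: "integrable \<mu> P"
  proof (rule haar_integrable[OF haar])
    show "norm (P U) \<le> 1 + \<eta>" if "U \<in> unitary_mats" for U
      using P_abs[OF that] power_le_one[OF trace_overlap_nonneg trace_overlap_le_1[OF that], of N] by simp
  qed
  define p where "p = (\<integral>U. P U \<partial>\<mu>)"
  have p: "p \<ge> e / 2"
  proof -
    have "e - \<eta> = (\<integral>U. trace_overlap U ^ N - \<eta> \<partial>\<mu>)"
      by (subst Bochner_Integration.integral_diff)
        (auto simp: e_def prob_space trace_overlap_integrable[OF haar])
    also have "\<dots> \<le> p"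
      unfolding p_def
    proof (rule integral_mono_AE)
      show "AE U in \<mu>. trace_overlap U ^ N - \<eta> \<le> P U"
        using haar_AE_unitary[OF haar]
      proof eventually_elim
        case (elim U)
        then show ?case using P_err[of U] by linarith
      qed
    qed (auto intro!: P_int Bochner_Integration.integrable_diff trace_overlap_integrable[OF haar])
    finally show ?thesis using eta_e by simp
  qed
  have p_pos: "p > 0" using p e_pos by simp
  show thesis
  proof (rule that[of "\<lambda>U. P U / p"])
    show "integrable \<mu> (\<lambda>U. P U / p)" using P_int by simp
    show "(\<integral>U. P U / p \<partial>\<mu>) = 1" using p_pos by (simp add: p_def[symmetric])
    have "balanced_poly k (\<lambda>U. complex_of_real (1 / p) * complex_of_real (P U))"
      unfolding P_def by (intro balanced_poly_cmult balanced_poly_poly_trace_overlap degree_truncated_power)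
    then show "balanced_poly k (\<lambda>U. complex_of_real (P U / p))"
      by (simp add: mult.commute)
    let ?t = "exp (- (\<epsilon>\<^sup>2 * real r))" and ?E = "exp (- (y2 / 4)) * (pi / 2) ^ (d * (d - 1))"
    let ?A = "{U \<in> unitary_mats. chan_dist U (mat 1) > \<epsilon>} :: (complex^'n^'n) set"
    have "(\<integral>\<^sup>+ U \<in> ?A. ennreal \<bar>P U / p\<bar> \<partial>\<mu>) \<le>
        (\<integral>\<^sup>+ U. ennreal ((?t * trace_overlap U ^ (2 * q) + \<eta>) / p) \<partial>\<mu>)"
    proof (rule nn_integral_mono)
      fix U :: "complex^'n^'n"
      show "ennreal \<bar>P U / p\<bar> * indicator ?A U \<le> ennreal ((?t * trace_overlap U ^ (2 * q) + \<eta>) / p)"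
      proof (cases "U \<in> ?A")
        case True
        then have U: "U \<in> unitary_mats" and "\<epsilon> < chan_dist U (mat 1)" by auto
        \<comment> \<open>Outside the ball the power of the overlap is reduced to two thirds of the
          exponent; this nonnegative bound is then integrated over the whole group.\<close>
        then have "\<bar>P U\<bar> \<le> ?t * trace_overlap U ^ (2 * q) + \<eta>"
          using P_abs[OF U] trace_overlap_power_tail[OF U eps, of r] unfolding Nq q_def by linarith
        then have "\<bar>P U / p\<bar> \<le> (?t * trace_overlap U ^ (2 * q) + \<eta>) / p"
          using p_pos by (simp add: divide_right_mono)
        with True show ?thesis by (simp add: ennreal_leI)
      qed simp
    qed
    also have "\<dots> = ennreal (\<integral>U. (?t * trace_overlap U ^ (2 * q) + \<eta>) / p \<partial>\<mu>)"
      by (intro nn_integral_eq_integral AE_I2 integrable_divide_zero Bochner_Integration.integrable_add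
          integrable_mult_right trace_overlap_integrable[OF haar] integrable_const)
        (use p_pos eta_pos in \<open>auto intro!: divide_nonneg_nonneg
          add_nonneg_nonneg mult_nonneg_nonneg zero_le_power trace_overlap_nonneg\<close>)
    also have "(\<integral>U. (?t * trace_overlap U ^ (2 * q) + \<eta>) / p \<partial>\<mu>) =
        (?t * (\<integral>U. trace_overlap U ^ (2 * q) \<partial>\<mu>) + \<eta>) / p"
      using trace_overlap_integrable[OF haar, of "2 * q"] by (simp add: prob_space)
    also have "\<dots> \<le> 9 * ?E"
    proof -
      have "(\<integral>U. trace_overlap U ^ (2 * q) \<partial>\<mu>) \<le> (3 / 2) ^ (d * d - 1) * e"
        using multi_energy_doubling[of "haar_moment \<mu>" q, OF haar_moment_raise[OF haar]]
        by (simp add: trace_overlap_moment_eq[OF haar] e_def Nq d_def)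
      moreover have "?t \<le> exp (- (y2 / 3))"
      proof -
        have "y2 / 3 = \<epsilon>\<^sup>2 * (1 / (3 * \<sigma>\<^sup>2))" by (simp add: y2_def)
        also have "\<dots> \<le> \<epsilon>\<^sup>2 * real r" using r by (intro mult_left_mono) auto
        finally show ?thesis by simp
      qed
      ultimately have "?t * (\<integral>U. trace_overlap U ^ (2 * q) \<partial>\<mu>) \<le>
          exp (- (y2 / 3)) * ((3 / 2) ^ (d * d - 1) * e)"
        by (intro mult_mono integral_nonneg_AE AE_I2) (auto intro: trace_overlap_nonneg)
      also have "\<dots> = (exp (- (y2 / 3)) * (3 / 2) ^ (d * d - 1)) * e" by simp
      also have "\<dots> \<le> ?E * e"
        using e_pos by (intro mult_right_mono three_halves_power_le d2 y2) simp
      finally have 1: "?t * (\<integral>U. trace_overlap U ^ (2 * q) \<partial>\<mu>) \<le> ?E * e" .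
      have "exp (- (y2 / 4)) * 1 \<le> ?E"
        using pi_gt3 by (intro mult_left_mono one_le_power) auto
      then have "e / 2 * exp (- (y2 / 4)) \<le> e / 2 * ?E"
        using e_pos by (intro mult_left_mono) auto
      with eta have "\<eta> \<le> e / 2 * ?E" by (rule order.trans)
      \<comment> \<open>The two contributions add up to \<open>3 * ?E * (e / 2)\<close>, so the
        constant reached before dividing by \<open>p\<close> is 3.\<close>
      with 1 have "?t * (\<integral>U. trace_overlap U ^ (2 * q) \<partial>\<mu>) + \<eta> \<le> ?E * e + e / 2 * ?E"
        by (rule add_mono)
      also have "\<dots> = 3 * ?E * (e / 2)"
        by simp
      also have "\<dots> \<le> 3 * ?E * p"
        using p by (intro mult_left_mono) auto
      also have "\<dots> \<le> 9 * ?E * p"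
        using p_pos by (intro mult_right_mono) auto
      finally show ?thesis using p_pos by (simp add: pos_divide_le_eq)
    qed
    also have "9 * ?E = 9 * exp (- (\<epsilon>^2 / (4 * \<sigma>^2))) * (pi / 2) ^ (d * (d - 1))"
      by (simp add: y2_def mult.commute)
    finally show "(\<integral>\<^sup>+ U \<in> ?A. ennreal \<bar>P U / p\<bar> \<partial>\<mu>)
      \<le> ennreal (9 * exp (- (\<epsilon>^2 / (4 * \<sigma>^2))) * (pi / 2) ^ (d * (d - 1)))"
      by (simp add: ennreal_leI)
    have "(\<integral>\<^sup>+ U. ennreal (\<bar>P U / p\<bar>^2) \<partial>\<mu>) \<le> (\<integral>\<^sup>+ U. ennreal ((2 * trace_overlap U ^ N + \<eta>\<^sup>2) / p\<^sup>2) \<partial>\<mu>)"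
    proof (rule nn_integral_mono_AE)
      show "AE U in \<mu>. ennreal (\<bar>P U / p\<bar>^2) \<le> ennreal ((2 * trace_overlap U ^ N + \<eta>\<^sup>2) / p\<^sup>2)"
        using haar_AE_unitary[OF haar]
      proof eventually_elim
        case (elim U)
        define z where "z = trace_overlap U ^ N"
        have z: "0 \<le> z" "z \<le> 1"
          unfolding z_def using trace_overlap_nonneg[of U] trace_overlap_le_1[OF elim] by (auto intro: power_le_one)
        have "\<bar>P U\<bar>\<^sup>2 \<le> (z + \<eta>)\<^sup>2"
          using P_abs[OF elim] by (intro power_mono) (auto simp: z_def)
        also have "\<dots> = z * (z + 2 * \<eta>) + \<eta>\<^sup>2" by (simp add: power2_eq_square algebra_simps)
        \<comment> \<open>Here \<open>z\<close> is at most 1, and \<open>2 * \<eta>\<close> is at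
          most \<open>e\<close>, hence at most 1. Bounding the square linearly in \<open>z\<close>
          leaves only the moment \<open>e\<close> to be integrated.\<close>
        also have "\<dots> \<le> z * 2 + \<eta>\<^sup>2"
          using z eta_e e_le by (intro add_right_mono mult_left_mono) auto
        finally show ?case
          unfolding z_def by (intro ennreal_leI) (simp add: power_divide divide_right_mono mult.commute)
      qed
    qed
    also have "\<dots> = ennreal (\<integral>U. (2 * trace_overlap U ^ N + \<eta>\<^sup>2) / p\<^sup>2 \<partial>\<mu>)"
      by (intro nn_integral_eq_integral AE_I2 integrable_divide_zero Bochner_Integration.integrable_add
          integrable_mult_right trace_overlap_integrable[OF haar] integrable_const)
        (use p_pos eta_pos in \<open>auto intro!: divide_nonneg_nonneg
          add_nonneg_nonneg mult_nonneg_nonneg zero_le_power trace_overlap_nonneg\<close>)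
    also have "(\<integral>U. (2 * trace_overlap U ^ N + \<eta>\<^sup>2) / p\<^sup>2 \<partial>\<mu>) = (2 * e + \<eta>\<^sup>2) / p\<^sup>2"
      using trace_overlap_integrable[OF haar, of N] by (simp add: prob_space e_def)
    also have "\<dots> \<le> X"
    proof -
      have "\<eta>\<^sup>2 \<le> (e / 2)\<^sup>2" using eta_e eta_pos by (intro power_mono) auto
      also have "\<dots> \<le> e / 4" using e_le e_pos by (simp add: power2_eq_square)
      finally have "2 * e + \<eta>\<^sup>2 \<le> 9 * (e / 4)" by simp
      also have "\<dots> \<le> X * e * (e / 4)"
        using eX e_pos by (intro mult_right_mono) auto
      also have "\<dots> = X * (e / 2)\<^sup>2" by (simp add: power2_eq_square)
      also have "\<dots> \<le> X * p\<^sup>2"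
        using p e_pos sig by (intro mult_left_mono power_mono) (auto simp: X_def)
      finally show ?thesis using p_pos by (simp add: pos_divide_le_eq)
    qed
    finally show "(\<integral>\<^sup>+ U. ennreal (\<bar>P U / p\<bar>^2) \<partial>\<mu>) \<le>
        ennreal (64 * 4 ^ (d\<^sup>2) * (1 / \<sigma>\<^sup>2) ^ (d\<^sup>2 - d) * (1 / \<sigma>) ^ d)"
      unfolding X_def by (simp add: ennreal_leI)
  qed
qed

text \<open>The exponents match because \<open>2 * (d^2 - d) + d\<close> equals
  \<open>2 * d * (d - 1/2)\<close>; this converts the integral bound into the form of property
  (4).\<close>

lemma norm_bound_eq_square:
  fixes \<sigma> :: real
  assumes "0 < \<sigma>"
  shows "64 * 4 ^ (d\<^sup>2) * (1 / \<sigma>\<^sup>2) ^ (d\<^sup>2 - d) * (1 / \<sigma>) ^ d =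
    (8 * 2 ^ (d\<^sup>2) * \<sigma> powr (- (real d * (real d - 1/2))))\<^sup>2"
proof -
  have d: "d \<le> d\<^sup>2" by (simp add: power2_eq_square)
  have s: "(1 / \<sigma>) ^ n = \<sigma> powr (- real n)" for n
    using assms by (simp add: powr_minus_divide powr_realpow power_one_over)
  have "(1 / \<sigma>\<^sup>2) ^ (d\<^sup>2 - d) * (1 / \<sigma>) ^ d = (1 / \<sigma>) ^ (2 * (d\<^sup>2 - d) + d)"
    by (simp add: power_add power_mult power_one_over)
  also have "\<dots> = \<sigma> powr (- 2 * real (d\<^sup>2 - d) - real d)"
    unfolding s by simp
  also have "- 2 * real (d\<^sup>2 - d) - real d = 2 * (- (real d * (real d - 1/2)))"
    using d by (simp add: of_nat_diff power2_eq_square algebra_simps)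
  also have "\<sigma> powr (2 * (- (real d * (real d - 1/2)))) = (\<sigma> powr (- (real d * (real d - 1/2))))\<^sup>2"
    using assms by (simp add: powr_power mult.commute)
  finally show ?thesis
    by (simp add: power_mult_distrib power_mult[symmetric] mult.commute[of _ 2]) (simp add: power_mult)
qed

text \<open>The proof splits on whether \<open>k\<close> reaches the threshold of property (2).
  Above it \<open>approximate_delta_exists\<close> supplies the kernel, below it the constant 1
  does.\<close>

theorem theorem1:
  fixes \<mu> :: "(complex^'n^'n) measure" and d :: nat and \<epsilon> \<sigma> :: real
  assumes d_def: "d = CARD('n)" and d2: "d \<ge> 2"
    and haar: "is_haar \<mu>"
    and eps: "0 < \<epsilon>" "\<epsilon> \<le> 1"
    and sig: "0 < \<sigma>" "\<sigma> \<le> \<epsilon> / (6 * sqrt d)"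
  shows "\<forall>k::nat. k > 0 \<longrightarrow> (\<exists>F :: complex^'n^'n \<Rightarrow> real.
     (integrable \<mu> F \<and> (\<integral>U. F U \<partial>\<mu>) = 1) \<and>
     (real k \<ge> 5 * (real d powr (3/2) / \<sigma>) *
                 sqrt (1/8 * (\<epsilon>^2 / (real d ^ 2 * \<sigma>^2)) + ln (1/\<sigma>))
        \<longrightarrow> (\<integral>\<^sup>+ U \<in> {U \<in> unitary_mats. chan_dist U (mat 1) > \<epsilon>}. ennreal \<bar>F U\<bar> \<partial>\<mu>)
            \<le> ennreal (9 * exp (- (\<epsilon>^2 / (4 * \<sigma>^2))) * (pi / 2) ^ (d * (d - 1)))) \<and>
     balanced_poly k (\<lambda>U. complex_of_real (F U)) \<and>
     (real k \<ge> real d / \<sigma>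
        \<longrightarrow> root 2 (enn2real (\<integral>\<^sup>+ U. ennreal (\<bar>F U\<bar>^2) \<partial>\<mu>)) \<le> 8 * 2 ^ (d^2) * \<sigma> powr (- (real d * (real d - 1/2)))
            \<and> (\<integral>\<^sup>+ U. ennreal (\<bar>F U\<bar>^2) \<partial>\<mu>) < \<infinity>))"
proof (intro allI impI)
  fix k :: nat
  let ?b = "8 * 2 ^ (d^2) * \<sigma> powr (- (real d * (real d - 1/2)))"
  interpret prob_space \<mu> by (rule haar_prob_space[OF haar])
  \<comment> \<open>Since \<open>enn2real\<close> sends infinity to 0, finiteness is derived
    separately from the same estimate.\<close>
  have norm_bound: "root 2 (enn2real (\<integral>\<^sup>+ U. ennreal (\<bar>F U\<bar>^2) \<partial>\<mu>)) \<le> ?b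
      \<and> (\<integral>\<^sup>+ U. ennreal (\<bar>F U\<bar>^2) \<partial>\<mu>) < \<infinity>"
    if F: "(\<integral>\<^sup>+ U. ennreal (\<bar>F U\<bar>^2) \<partial>\<mu>) \<le> ennreal (?b\<^sup>2)" for F :: "complex^'n^'n \<Rightarrow> real"
  proof
    have "enn2real (\<integral>\<^sup>+ U. ennreal (\<bar>F U\<bar>^2) \<partial>\<mu>) \<le> ?b\<^sup>2"
      using F by (intro enn2real_leI) auto
    then have "sqrt (enn2real (\<integral>\<^sup>+ U. ennreal (\<bar>F U\<bar>^2) \<partial>\<mu>)) \<le> sqrt (?b\<^sup>2)"
      by (rule real_sqrt_le_mono)
    then show "root 2 (enn2real (\<integral>\<^sup>+ U. ennreal (\<bar>F U\<bar>^2) \<partial>\<mu>)) \<le> ?b"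
      by (simp add: sqrt_def[symmetric] abs_mult)
    show "(\<integral>\<^sup>+ U. ennreal (\<bar>F U\<bar>^2) \<partial>\<mu>) < \<infinity>"
      using F by (rule order.strict_trans1) simp
  qed
  show "\<exists>F :: complex^'n^'n \<Rightarrow> real.
     (integrable \<mu> F \<and> (\<integral>U. F U \<partial>\<mu>) = 1) \<and>
     (real k \<ge> 5 * (real d powr (3/2) / \<sigma>) *
                 sqrt (1/8 * (\<epsilon>^2 / (real d ^ 2 * \<sigma>^2)) + ln (1/\<sigma>))
        \<longrightarrow> (\<integral>\<^sup>+ U \<in> {U \<in> unitary_mats. chan_dist U (mat 1) > \<epsilon>}. ennreal \<bar>F U\<bar> \<partial>\<mu>)
            \<le> ennreal (9 * exp (- (\<epsilon>^2 / (4 * \<sigma>^2))) * (pi / 2) ^ (d * (d - 1)))) \<and>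
     balanced_poly k (\<lambda>U. complex_of_real (F U)) \<and>
     (real k \<ge> real d / \<sigma>
        \<longrightarrow> root 2 (enn2real (\<integral>\<^sup>+ U. ennreal (\<bar>F U\<bar>^2) \<partial>\<mu>)) \<le> ?b
            \<and> (\<integral>\<^sup>+ U. ennreal (\<bar>F U\<bar>^2) \<partial>\<mu>) < \<infinity>)"
  proof (cases "real k \<ge> 5 * (real d powr (3/2) / \<sigma>) *
                 sqrt (1/8 * (\<epsilon>^2 / (real d ^ 2 * \<sigma>^2)) + ln (1/\<sigma>))")
    case True
    obtain F :: "complex^'n^'n \<Rightarrow> real" where F: "integrable \<mu> F" "(\<integral>U. F U \<partial>\<mu>) = 1"
      "(\<integral>\<^sup>+ U \<in> {U \<in> unitary_mats. chan_dist U (mat 1) > \<epsilon>}. ennreal \<bar>F U\<bar> \<partial>\<mu>)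
        \<le> ennreal (9 * exp (- (\<epsilon>^2 / (4 * \<sigma>^2))) * (pi / 2) ^ (d * (d - 1)))"
      "balanced_poly k (\<lambda>U. complex_of_real (F U))"
      "(\<integral>\<^sup>+ U. ennreal (\<bar>F U\<bar>^2) \<partial>\<mu>) \<le> ennreal (?b\<^sup>2)"
      using approximate_delta_exists[OF d_def d2 haar eps sig True]
      unfolding norm_bound_eq_square[OF sig(1)] by blast
    show ?thesis
      by (intro exI[of _ F] conjI impI F norm_bound[OF F(5), THEN conjunct1] norm_bound[OF F(5), THEN conjunct2])
  next
    case False
    \<comment> \<open>For the constant kernel property (2) is vacuous, and its norm 1 is below the
      bound because a negative power of \<open>\<sigma>\<close> is at least 1 once
      \<open>\<sigma>\<close> is at most 1.\<close>
    have "\<sigma> \<le> 1"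
    proof -
      have "1 \<le> 6 * sqrt d" using real_sqrt_le_mono[of 1 "real d"] d2 unfolding real_sqrt_one by linarith
      then have "\<epsilon> / (6 * sqrt d) \<le> 1 / 1" using eps by (intro frac_le) auto
      with sig show ?thesis by simp
    qed
    then have "\<sigma> powr 0 \<le> \<sigma> powr (- (real d * (real d - 1/2)))"
      using sig d2 by (intro powr_mono') auto
    moreover have "1 \<le> 8 * (2::real) ^ d\<^sup>2"
      using one_le_power[of "2::real" "d\<^sup>2"] by linarith
    ultimately have "1 * 1 \<le> ?b"
      using sig by (intro mult_mono) auto
    then have "1 \<le> ?b\<^sup>2"
      by (simp only: one_le_power mult_1)
    then have "ennreal 1 \<le> ennreal (?b\<^sup>2)"
      by (rule ennreal_leI)
    moreover have "(\<integral>\<^sup>+ U. ennreal (\<bar>1\<bar>^2) \<partial>\<mu>) = ennreal 1"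
      by (simp add: emeasure_space_1)
    ultimately have "(\<integral>\<^sup>+ U. ennreal (\<bar>1\<bar>^2) \<partial>\<mu>) \<le> ennreal (?b\<^sup>2)"
      by simp
    from norm_bound[OF this] False show ?thesis
      by (intro exI[of _ "\<lambda>_. 1"]) (simp add: prob_space balanced_poly_const)
  qed
qed

end
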